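(* Let $f:\mathbb{R}^d\to\mathbb{R}$ be differentiable and bounded from below, with $\nabla f$ Lipschitz continuous with parameter $\mathsf{L}>0$. Let $\{\boldsymbol{x}^k\}_k$ be generated by the stochastic gradient method with momentum (SGDM, see context) with momentum parameters $\lambda\in[0,1)$ and $\nu\ge 0$, where the stochastic errors satisfy $\mathbb{E}[\boldsymbol{e}^k\mid\mathcal{F}_k]=0$ and $\mathbb{E}[\|\boldsymbol{e}^k\|^2\mid\mathcal{F}_k]\le\sigma^2$ almost surely for all $k$ (for some constant $\sigma\ge0$), and where the step sizes $\{\alpha_k\}_k\subset(0,\infty)$ are non-increasing with $\sum_{k=1}^\infty\alpha_k=\infty$ and $\sum_{k=1}^\infty\alpha_k^2<\infty$. Let $\{\boldsymbol{z}^k\}_k$ and $\{\boldsymbol{d}_k\}_k$ be the associated processes defined in the context, using the time window $\mathsf{T}=\frac{(1-\lambda)^3}{50\mathsf{L}(1+2\nu)^2}$. Then: (a) Almost surely, $\lim_{k\to\infty}\boldsymbol{d}_k=0$, $\lim_{k\to\infty}\|\boldsymbol{x}^k-\boldsymbol{z}^k\|=0$, $\lim_{k\to\infty}\|\nabla f(\boldsymbol{x}^k)\|=0$, and $\lim_{k\to\infty}\|\nabla f(\boldsymbol{z}^k)\|=0$. (b) There is $\boldsymbol{f}^*:\Omega\to\mathbb{R}$ such that $\{f(\boldsymbol{x}^k)\}_k$ and $\{f(\boldsymbol{z}^k)\}_k$ both converge to $\boldsymbol{f}^*$ almost surely.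
   Context: SGDM: on a probability space $(\Omega,\mathcal{F},\mathbb{P})$, with deterministic initial points $\boldsymbol{x}^1=\boldsymbol{x}^0=x^0\in\mathbb{R}^d$, deterministic step sizes $\alpha_k>0$ and parameters $\lambda\in[0,1)$, $\nu\ge0$, SGDM generates the stochastic process given for $k\ge1$ by $$\tilde{\boldsymbol{x}}^k=\boldsymbol{x}^k+\nu(\boldsymbol{x}^k-\boldsymbol{x}^{k-1}),\quad \boldsymbol{g}^k=\nabla f(\tilde{\boldsymbol{x}}^k)-\boldsymbol{e}^k,\quad \boldsymbol{x}^{k+1}=\boldsymbol{x}^k-\alpha_k\boldsymbol{g}^k+\lambda(\boldsymbol{x}^k-\boldsymbol{x}^{k-1}),$$ where $\boldsymbol{e}^k:\Omega\to\mathbb{R}^d$ are random vectors (stochastic errors). The filtration is $\mathcal{F}_k=\sigma(\boldsymbol{x}^0,\boldsymbol{x}^1,\dots,\boldsymbol{x}^k)$. Auxiliary sequence: $\boldsymbol{z}^k=\frac{1}{1-\lambda}\boldsymbol{x}^k-\frac{\lambda}{1-\lambda}\boldsymbol{x}^{k-1}$ for $k\ge1$. Time window and time indices: let $\Delta_{k,k}=0$ and $\Delta_{k,n}=\sum_{i=k}^{n-1}\alpha_i$ for $k<n$. For a time window $\mathsf{T}>0$ let $\varpi(k,\mathsf{T})=\max\{k+1,\sup\{n\ge k:\Delta_{k,n}\le\mathsf{T}\}\}$; the time indices are $\gamma_1=1$, $\gamma_{k+1}=\varpi(\gamma_k,\mathsf{T})$, and $\Gamma_k=\{t\in\mathbb{N}:\gamma_k<t\le\gamma_{k+1}\}$.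 Iterate distance: $\boldsymbol{d}_k=\max\{\max_{\ell\in\Gamma_k}\|\boldsymbol{x}^\ell-\boldsymbol{x}^{\gamma_k}\|,\ \max_{\ell\in\Gamma_k}\|\boldsymbol{z}^\ell-\boldsymbol{z}^{\gamma_k}\|\}$. *)

theory Defs
  imports "HOL-Probability.Probability"
begin

definition gradient :: "(real ^ 'd \<Rightarrow> real) \<Rightarrow> real ^ 'd \<Rightarrow> real ^ 'd" where
  "gradient f x = (THE D. GDERIV f x :> D)"

lemma gradient_eqI:
  assumes "GDERIV f x :> D"
  shows "gradient f x = D"
  unfolding gradient_def
proof (rule the_equality)
  fix D' assume "GDERIV f x :> D'"
  with assms have "(\<lambda>h. h \<bullet> D') = (\<lambda>h. h \<bullet> D)"
    unfolding gderiv_def by (rule has_derivative_unique[rotated])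
  then show "D' = D"
    by (metis inner_commute vector_eq_rdot)
qed (rule assms)

text \<open>
  The conditional expectation of a random vector is taken componentwise. It carries its usual
  meaning only for integrable random vectors.
\<close>

definition vec_cond_exp ::
  "'a measure \<Rightarrow> 'a measure \<Rightarrow> ('a \<Rightarrow> real ^ 'd) \<Rightarrow> 'a \<Rightarrow> real ^ 'd" where
  "vec_cond_exp M F X \<omega> = (\<chi> i. real_cond_exp M F (\<lambda>\<omega>'. X \<omega>' $ i) \<omega>)"

definition natural_filtration ::
  "'a measure \<Rightarrow> (nat \<Rightarrow> 'a \<Rightarrow> real ^ 'd) \<Rightarrow> nat \<Rightarrow> 'a measure" where
  "natural_filtration M x k =
     sigma (space M) {x i -` B \<inter> space M | i B. i \<le> k \<and> B \<in> sets borel}"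

text \<open>
  Time runs over \<open>k \<ge> 1\<close>, with \<open>x 0\<close> only serving to start the momentum recursion;
  the values \<open>\<alpha> 0\<close> and \<open>e 0\<close> play no role.
\<close>

definition sgdm ::
  "'a measure \<Rightarrow> (real ^ 'd \<Rightarrow> real) \<Rightarrow> (nat \<Rightarrow> real) \<Rightarrow> real \<Rightarrow> real \<Rightarrow> real ^ 'd \<Rightarrow>
   (nat \<Rightarrow> 'a \<Rightarrow> real ^ 'd) \<Rightarrow> (nat \<Rightarrow> 'a \<Rightarrow> real ^ 'd) \<Rightarrow> bool" where
  "sgdm M f \<alpha> lam \<nu> x0 e x \<longleftrightarrow>
     (\<forall>\<omega>\<in>space M. x 0 \<omega> = x0 \<and> x 1 \<omega> = x0 \<and>
       (\<forall>k\<ge>1.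
         let xt = x k \<omega> + \<nu> *\<^sub>R (x k \<omega> - x (k - 1) \<omega>);
             g = gradient f xt - e k \<omega>
         in x (k + 1) \<omega> = x k \<omega> - \<alpha> k *\<^sub>R g + lam *\<^sub>R (x k \<omega> - x (k - 1) \<omega>)))"

text \<open>Meaningful for \<open>k \<ge> 1\<close> only.\<close>

definition aux_seq :: "real \<Rightarrow> (nat \<Rightarrow> 'a \<Rightarrow> real ^ 'd) \<Rightarrow> nat \<Rightarrow> 'a \<Rightarrow> real ^ 'd" where
  "aux_seq lam x k \<omega> = (1 / (1 - lam)) *\<^sub>R x k \<omega> - (lam / (1 - lam)) *\<^sub>R x (k - 1) \<omega>"

definition step_sum :: "(nat \<Rightarrow> real) \<Rightarrow> nat \<Rightarrow> nat \<Rightarrow> real" where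
  "step_sum \<alpha> k n = (\<Sum>i\<in>{k..<n}. \<alpha> i)"

text \<open>
  The supremum is that of a finite nonempty set of natural numbers whenever \<open>T \<ge> 0\<close> and the
  step sizes have a divergent sum.
\<close>

definition next_index :: "(nat \<Rightarrow> real) \<Rightarrow> real \<Rightarrow> nat \<Rightarrow> nat" where
  "next_index \<alpha> T k = max (k + 1) (Sup {n. n \<ge> k \<and> step_sum \<alpha> k n \<le> T})"

text \<open>The sequence of time indices starts at \<open>1\<close>; the value at \<open>0\<close> is a dummy.\<close>

fun time_index :: "(nat \<Rightarrow> real) \<Rightarrow> real \<Rightarrow> nat \<Rightarrow> nat" where
  "time_index \<alpha> T 0 = 0"
| "time_index \<alpha> T (Suc 0) = 1"
| "time_index \<alpha> T (Suc (Suc k)) = next_index \<alpha> T (time_index \<alpha> T (Suc k))"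

definition time_block :: "(nat \<Rightarrow> real) \<Rightarrow> real \<Rightarrow> nat \<Rightarrow> nat set" where
  "time_block \<alpha> T k = {t. time_index \<alpha> T k < t \<and> t \<le> time_index \<alpha> T (k + 1)}"

definition iterate_dist ::
  "(nat \<Rightarrow> real) \<Rightarrow> real \<Rightarrow> real \<Rightarrow> (nat \<Rightarrow> 'a \<Rightarrow> real ^ 'd) \<Rightarrow> nat \<Rightarrow> 'a \<Rightarrow> real" where
  "iterate_dist \<alpha> T lam x k \<omega> =
     max (MAX l\<in>time_block \<alpha> T k. norm (x l \<omega> - x (time_index \<alpha> T k) \<omega>))
         (MAX l\<in>time_block \<alpha> T k.
            norm (aux_seq lam x l \<omega> - aux_seq lam x (time_index \<alpha> T k) \<omega>))"

end

theory Submission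
  imports Defs
begin

text \<open>
  Write \<open>g\<close> for the gradient of \<open>f\<close>, \<open>q\<close> for the point at which the
  method evaluates it, and \<open>m\<close> for the last displacement. In terms of the auxiliary iterates the
  method is plain stochastic gradient descent,
  \<open>z' = z - b * (g q - e)\<close> with \<open>b = \<alpha> / (1 - lam)\<close>, except that the gradient is taken
  at a point whose distance to \<open>z\<close> is a fixed multiple of \<open>norm m\<close>.

  Once the steps are small, the energy \<open>f z + (norm m)\<^sup>2\<close> therefore decreases in
  expectation, up to a multiple of
  \<open>\<alpha>\<^sup>2\<close>, by an amount controlling \<open>\<alpha> * (norm (g z))\<^sup>2\<close>, \<open>\<alpha> * (norm (g q))\<^sup>2\<close> and
  \<open>(norm m)\<^sup>2\<close> (\<open>energy_decrease\<close>). As \<open>f\<close> is bounded below and the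
  \<open>\<alpha>\<^sup>2\<close> are summable, these three amounts have a finite total expectation, so almost surely
  they form convergent series (\<open>mean_dissipation_summable\<close>).

  The noise enters only through series \<open>\<Sum>k. Y k \<bullet> e k\<close> whose weight \<open>Y k\<close> is
  determined by the past. Such series converge almost surely as soon as the second moments of the
  weights are summable, by Kolmogorov's maximal inequality (\<open>AE_noise_series_summable\<close>). Applied
  with constant weights \<open>\<alpha> k *\<^sub>R b\<close>, this gives convergence of \<open>\<Sum>k. \<alpha> k *\<^sub>R e k\<close>;
  applied with \<open>\<alpha> k *\<^sub>R g (z k)\<close>, whose second moments are summable by the energy estimate, it
  gives convergence of the fluctuations of \<open>f z\<close>. Thus almost every trajectory is tame
  (\<open>AE_tame\<close>), and the rest of the argument concerns one tame trajectory.

  There \<open>m\<close> tends to \<open>0\<close>, hence so does \<open>x - z\<close>. The increments of \<open>f (z k)\<close>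
  form a convergent series, so \<open>f (z k)\<close> converges. Over a window of bounded length in the clock
  \<open>\<Sum>\<alpha>\<close> the noise contributes a Cauchy block and the drift is small because
  \<open>\<Sum>k. \<alpha> k * (norm (g (q k)))\<^sup>2\<close> converges, so the path hardly moves (\<open>z_window_small\<close>); this is the convergence of the iterate
  distances, because a time block has clock length at most \<open>T\<close> plus one step. Finally, since the
  clock diverges while \<open>\<Sum>k. \<alpha> k * (norm (g (z k)))\<^sup>2\<close> converges, every late window of
  length \<open>1\<close> contains a point with small gradient, and Lipschitz continuity carries this over to
  its starting point (\<open>gradient_z_tendsto_0\<close>).
\<close>

lemma norm_diff_square_le:
  fixes u v :: "'b :: real_inner"
  shows "(norm (u - v))\<^sup>2 \<le> 2 * ((norm u)\<^sup>2 + (norm v)\<^sup>2)"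
proof -
  have "0 \<le> (norm (u + v))\<^sup>2"
    by simp
  then show ?thesis
    by (simp add: power2_norm_eq_inner inner_diff inner_add_left inner_add_right inner_commute)
qed

section \<open>Objectives with Lipschitz gradient\<close>

locale smooth_objective =
  fixes f :: "real ^ 'd \<Rightarrow> real" and L :: real
  assumes differentiable: "f differentiable_on UNIV"
    and gradient_lipschitz: "L-lipschitz_on UNIV (gradient f)"
    and L_pos: "L > 0"
begin

lemma has_gradient: "GDERIV f u :> gradient f u"
proof -
  from differentiable obtain f' where f': "(f has_derivative f') (at u)"
    by (auto simp: differentiable_on_def differentiable_def)
  then interpret linear f'
    by (rule has_derivative_linear)
  have "f' h = h \<bullet> (\<Sum>b\<in>Basis. f' b *\<^sub>R b)" for h
  proof -
    have "f' h = f' (\<Sum>b\<in>Basis. (h \<bullet> b) *\<^sub>R b)"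
      by (simp add: euclidean_representation)
    also have "\<dots> = (\<Sum>b\<in>Basis. (h \<bullet> b) * f' b)"
      by (simp add: sum scaleR)
    finally show ?thesis
      by (simp add: inner_sum_right mult.commute)
  qed
  then have "f' = (\<lambda>h. h \<bullet> (\<Sum>b\<in>Basis. f' b *\<^sub>R b))"
    by blast
  with f' have "GDERIV f u :> (\<Sum>b\<in>Basis. f' b *\<^sub>R b)"
    unfolding gderiv_def by metis
  with gradient_eqI[OF this] show ?thesis
    by simp
qed

lemma gradient_dist: "norm (gradient f u - gradient f v) \<le> L * norm (u - v)"
  using lipschitz_onD[OF gradient_lipschitz, of u v] by (simp add: dist_norm)

lemma gradient_tendsto_diff:
  assumes "(\<lambda>k. norm (u k - v k)) \<longlonglongrightarrow> 0"
  shows "(\<lambda>k. gradient f (u k) - gradient f (v k)) \<longlonglongrightarrow> 0"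
proof (rule Lim_null_comparison)
  show "(\<lambda>k. L * norm (u k - v k)) \<longlonglongrightarrow> 0"
    using tendsto_mult_left[OF assms, of L] by simp
qed (simp add: gradient_dist)

lemma continuous_f: "continuous_on UNIV f"
  using differentiable by (rule differentiable_imp_continuous_on)

lemma continuous_gradient: "continuous_on UNIV (gradient f)"
  using gradient_lipschitz by (rule lipschitz_on_continuous_on)

lemma measurable_f [measurable]: "f \<in> borel_measurable borel"
  using continuous_f by (rule borel_measurable_continuous_onI)

lemma measurable_gradient [measurable]: "gradient f \<in> borel_measurable borel"
  using continuous_gradient by (rule borel_measurable_continuous_onI)

text \<open>
  By the mean value theorem, the increment is the gradient at an intermediate point applied to
  the displacement. The optimal constant would be \<open>L / 2\<close>; \<open>L\<close> is enough for
  all later estimates.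
\<close>

lemma first_order_error:
  "\<bar>f v - f u - gradient f u \<bullet> (v - u)\<bar> \<le> L * (norm (v - u))\<^sup>2"
proof -
  define h where "h t = f (u + t *\<^sub>R (v - u))" for t :: real
  have "(h has_derivative (\<lambda>s. (s *\<^sub>R (v - u)) \<bullet> gradient f (u + t *\<^sub>R (v - u))))
      (at t within {0..1})" for t
    unfolding h_def
    by (rule has_derivative_compose[OF _ has_gradient[unfolded gderiv_def]])
      (auto intro!: derivative_eq_intros)
  then obtain t where t: "t \<in> {0..1}"
    and "h 1 - h 0 = ((1 - 0) *\<^sub>R (v - u)) \<bullet> gradient f (u + t *\<^sub>R (v - u))"
    using mvt_very_simple[of 0 1 h "\<lambda>t s. (s *\<^sub>R (v - u)) \<bullet> gradient f (u + t *\<^sub>R (v - u))"]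
    by auto
  then have "f v - f u - gradient f u \<bullet> (v - u)
      = (gradient f (u + t *\<^sub>R (v - u)) - gradient f u) \<bullet> (v - u)"
    by (simp add: h_def inner_diff_left inner_diff_right inner_commute)
  also have "\<bar>\<dots>\<bar> \<le> norm (gradient f (u + t *\<^sub>R (v - u)) - gradient f u) * norm (v - u)"
    by (rule Cauchy_Schwarz_ineq2)
  also have "\<dots> \<le> (L * norm (v - u)) * norm (v - u)"
  proof (rule mult_right_mono)
    have "norm (gradient f (u + t *\<^sub>R (v - u)) - gradient f u) \<le> L * (t * norm (v - u))"
      using gradient_dist[of "u + t *\<^sub>R (v - u)" u] t by simp
    also have "\<dots> \<le> L * (1 * norm (v - u))"
      using t L_pos by (intro mult_left_mono mult_right_mono) auto
    finally show "norm (gradient f (u + t *\<^sub>R (v - u)) - gradient f u) \<le> L * norm (v - u)"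
      by simp
  qed simp
  finally show ?thesis
    by (simp add: power2_eq_square)
qed

end

section \<open>Step sizes\<close>

locale step_sizes =
  fixes a :: "nat \<Rightarrow> real"
  assumes step_pos: "a k > 0"
    and step_decseq: "decseq a"
    and step_diverges: "\<not> summable a"
    and step_square_summable: "summable (\<lambda>k. (a k)\<^sup>2)"
begin

lemma step_le_first: "a k \<le> a 0"
  using step_decseq by (simp add: decseqD)

lemma step_tendsto_0: "a \<longlonglongrightarrow> 0"
  using summable_LIMSEQ_zero[OF step_square_summable]
  by (simp add: tendsto_power_zero)

lemma step_sum_unbounded: "\<exists>t\<ge>s. C < (\<Sum>k=s..<t. a k)"
proof (rule ccontr)
  assume *: "\<not> ?thesis"
  have "summable (\<lambda>k. a (k + s))"
  proof (rule summableI_nonneg_bounded)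
    show "(\<Sum>k<n. a (k + s)) \<le> C" for n
    proof -
      have "(\<Sum>k<n. a (k + s)) = (\<Sum>k=s..<s + n. a k)"
        using sum.shift_bounds_nat_ivl[of a 0 s n] by (simp add: lessThan_atLeast0 add.commute)
      with * show ?thesis
        by (metis le_add1 linorder_not_less)
    qed
  qed (simp add: step_pos less_imp_le)
  with step_diverges show False
    by simp
qed

end

section \<open>Trajectories of the momentum method\<close>

text \<open>
  The recursion for one fixed outcome, indexed so that the first iterate is \<open>y 0\<close>:
  \<open>m k\<close> is the displacement into \<open>y k\<close>, \<open>q k\<close> the point at which the gradient is evaluated,
  and \<open>z k\<close> the auxiliary iterate.
\<close>

locale momentum_path = smooth_objective f L + step_sizes a
  for f :: "real ^ 'd \<Rightarrow> real" and L :: real and a :: "nat \<Rightarrow> real" +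
  fixes lam nu :: real and y m q z e :: "nat \<Rightarrow> real ^ 'd"
  assumes lam_nonneg: "0 \<le> lam" and lam_less_1: "lam < 1"
    and m_Suc: "m (Suc k) = lam *\<^sub>R m k - a k *\<^sub>R (gradient f (q k) - e k)"
    and y_Suc: "y (Suc k) = y k + m (Suc k)"
    and q_eq: "q k = y k + nu *\<^sub>R m k"
    and z_eq: "z k = y k + (lam / (1 - lam)) *\<^sub>R m k"
begin

text \<open>The auxiliary iterates perform plain stochastic gradient steps: the momentum cancels.\<close>

lemma z_Suc: "z (Suc k) = z k - (a k / (1 - lam)) *\<^sub>R (gradient f (q k) - e k)"
proof -
  define w where "w = a k *\<^sub>R (gradient f (q k) - e k)"
  have "z (Suc k) = y k + (1 + lam / (1 - lam)) *\<^sub>R m (Suc k)"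
    by (simp add: z_eq y_Suc scaleR_add_left)
  also have "1 + lam / (1 - lam) = 1 / (1 - lam)"
    using lam_less_1 by (simp add: field_simps)
  also have "m (Suc k) = lam *\<^sub>R m k - w"
    by (simp add: m_Suc w_def)
  finally show ?thesis
    by (simp add: z_eq scaleR_diff_right w_def)
qed

lemma q_minus_z: "q k - z k = (nu - lam / (1 - lam)) *\<^sub>R m k"
  by (simp add: q_eq z_eq scaleR_diff_left)

text \<open>
  The bound is two-sided: it yields the energy estimate as well as the convergence of the
  objective values along single trajectories.
\<close>

lemma objective_increment:
  fixes k defines "b \<equiv> a k / (1 - lam)"
  shows "\<bar>f (z (Suc k)) - f (z k) + b * (gradient f (z k) \<bullet> gradient f (q k))
           - b * (gradient f (z k) \<bullet> e k)\<bar>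
         \<le> 2 * L * b\<^sup>2 * ((norm (gradient f (q k)))\<^sup>2 + (norm (e k))\<^sup>2)"
proof -
  have step: "z (Suc k) - z k = - (b *\<^sub>R (gradient f (q k) - e k))"
    by (simp add: z_Suc b_def)
  have "f (z (Suc k)) - f (z k) + b * (gradient f (z k) \<bullet> gradient f (q k))
           - b * (gradient f (z k) \<bullet> e k)
      = f (z (Suc k)) - f (z k) - gradient f (z k) \<bullet> (z (Suc k) - z k)"
    by (simp add: step inner_diff_right algebra_simps)
  also have "\<bar>\<dots>\<bar> \<le> L * (norm (z (Suc k) - z k))\<^sup>2"
    by (rule first_order_error)
  also have "(norm (z (Suc k) - z k))\<^sup>2 = b\<^sup>2 * (norm (gradient f (q k) - e k))\<^sup>2"
    by (simp add: step power_mult_distrib)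
  also have "L * (b\<^sup>2 * (norm (gradient f (q k) - e k))\<^sup>2)
      \<le> L * (b\<^sup>2 * (2 * ((norm (gradient f (q k)))\<^sup>2 + (norm (e k))\<^sup>2)))"
    using L_pos by (intro mult_left_mono norm_diff_square_le) auto
  finally show ?thesis
    by (simp only: mult_ac)
qed

text \<open>
  The new displacement is a convex combination, with weights \<open>lam\<close> and \<open>1 - lam\<close>, of the old
  one and of a vector of length \<open>r = a k * norm w / (1 - lam)\<close>.
\<close>

lemma momentum_increment:
  "(norm (m (Suc k)))\<^sup>2 \<le> lam * (norm (m k))\<^sup>2
     + 2 * (a k)\<^sup>2 / (1 - lam) * ((norm (gradient f (q k)))\<^sup>2 + (norm (e k))\<^sup>2)"
proof -
  define w where "w = gradient f (q k) - e k"
  define r where "r = a k * norm w / (1 - lam)"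
  have w: "(norm w)\<^sup>2 \<le> 2 * ((norm (gradient f (q k)))\<^sup>2 + (norm (e k))\<^sup>2)"
    unfolding w_def by (rule norm_diff_square_le)
  have "norm (m (Suc k)) \<le> norm (lam *\<^sub>R m k) + norm (a k *\<^sub>R w)"
    unfolding m_Suc w_def by (rule norm_triangle_ineq4)
  also have "\<dots> = lam * norm (m k) + (1 - lam) * r"
    using lam_nonneg lam_less_1 step_pos[of k] by (simp add: r_def)
  finally have "(norm (m (Suc k)))\<^sup>2 \<le> (lam * norm (m k) + (1 - lam) * r)\<^sup>2"
    by (rule power_mono) simp
  \<comment> \<open>convexity of the square\<close>
  also have "\<dots> \<le> lam * (norm (m k))\<^sup>2 + (1 - lam) * r\<^sup>2"
  proof -
    have "0 \<le> lam * (1 - lam) * (norm (m k) - r)\<^sup>2"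
      using lam_nonneg lam_less_1 by simp
    then show ?thesis
      by (simp add: power2_eq_square algebra_simps)
  qed
  also have "(1 - lam) * r\<^sup>2 = (a k)\<^sup>2 / (1 - lam) * (norm w)\<^sup>2"
    using lam_less_1 by (simp add: r_def power2_eq_square)
  also have "\<dots> \<le> (a k)\<^sup>2 / (1 - lam)
      * (2 * ((norm (gradient f (q k)))\<^sup>2 + (norm (e k))\<^sup>2))"
    using w lam_less_1 by (intro mult_left_mono) auto
  also have "\<dots> = 2 * (a k)\<^sup>2 / (1 - lam) * ((norm (gradient f (q k)))\<^sup>2 + (norm (e k))\<^sup>2)"
    by simp
  finally show ?thesis
    by simp
qed

text \<open>
  The energy \<open>f (z k) + (norm (m k))\<^sup>2\<close> decreases up to noise once the steps are small.
  The gradient is taken at \<open>q k\<close> instead of \<open>z k\<close>; by Lipschitz continuity this costs a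
  multiple of \<open>a k * (norm (m k))\<^sup>2\<close>, which the geometric decay of the momentum absorbs.
\<close>

lemma energy_decrease:
  fixes k
  defines "b \<equiv> a k / (1 - lam)"
  assumes small1: "b * (L\<^sup>2 * (nu - lam / (1 - lam))\<^sup>2) \<le> 1 - lam"
    and small2: "2 * L * b\<^sup>2 + 2 * (a k)\<^sup>2 / (1 - lam) \<le> b / 4"
  shows "f (z (Suc k)) + (norm (m (Suc k)))\<^sup>2
      + (b / 4 * ((norm (gradient f (z k)))\<^sup>2 + (norm (gradient f (q k)))\<^sup>2)
         + (1 - lam) / 2 * (norm (m k))\<^sup>2)
    \<le> f (z k) + (norm (m k))\<^sup>2 + b * (gradient f (z k) \<bullet> e k)
      + (2 * L / (1 - lam)\<^sup>2 + 2 / (1 - lam)) * ((a k)\<^sup>2 * (norm (e k))\<^sup>2)"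
proof -
  define G where "G = (norm (gradient f (z k)))\<^sup>2"
  define H where "H = (norm (gradient f (q k)))\<^sup>2"
  define E where "E = (norm (e k))\<^sup>2"
  define P where "P = gradient f (z k) \<bullet> gradient f (q k)"
  define c where "c = 2 * L * b\<^sup>2 + 2 * (a k)\<^sup>2 / (1 - lam)"
  have b: "b > 0"
    using step_pos[of k] lam_less_1 by (simp add: b_def)
  have "(norm (gradient f (z k) - gradient f (q k)))\<^sup>2 = G + H - 2 * P"
    by (simp add: G_def H_def P_def power2_norm_eq_inner inner_diff_left inner_diff_right
        inner_commute)
  moreover have "(norm (gradient f (z k) - gradient f (q k)))\<^sup>2 \<le> (L * norm (z k - q k))\<^sup>2"
    by (intro power_mono gradient_dist) simp
  moreover have "(L * norm (z k - q k))\<^sup>2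
      = L\<^sup>2 * (nu - lam / (1 - lam))\<^sup>2 * (norm (m k))\<^sup>2"
    by (simp add: norm_minus_commute[of "z k"] q_minus_z power_mult_distrib)
  ultimately have "G + H - 2 * P \<le> L\<^sup>2 * (nu - lam / (1 - lam))\<^sup>2 * (norm (m k))\<^sup>2"
    by simp
  then have "b * (G + H - 2 * P) \<le> b * (L\<^sup>2 * (nu - lam / (1 - lam))\<^sup>2 * (norm (m k))\<^sup>2)"
    using b by simp
  also have "\<dots> \<le> (1 - lam) * (norm (m k))\<^sup>2"
    using mult_right_mono[OF small1, of "(norm (m k))\<^sup>2"] by (simp add: mult.assoc)
  finally have inner: "b * P \<ge> b / 2 * (G + H) - (1 - lam) / 2 * (norm (m k))\<^sup>2"
    by (simp add: field_simps)
  have "c * H \<le> b / 4 * (G + H)"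
  proof -
    have "c * H \<le> b / 4 * H"
      using small2 by (intro mult_right_mono) (auto simp: c_def H_def)
    also have "\<dots> \<le> b / 4 * (G + H)"
      using b by (intro mult_left_mono) (auto simp: G_def)
    finally show ?thesis .
  qed
  moreover have "f (z (Suc k)) \<le> f (z k) - b * P + b * (gradient f (z k) \<bullet> e k)
      + 2 * L * b\<^sup>2 * (H + E)"
    using objective_increment[of k] by (simp add: b_def P_def H_def E_def abs_le_iff)
  moreover have "(norm (m (Suc k)))\<^sup>2 \<le> lam * (norm (m k))\<^sup>2 + 2 * (a k)\<^sup>2 / (1 - lam) * (H + E)"
    using momentum_increment[of k] by (simp add: H_def E_def)
  moreover have "2 * L * b\<^sup>2 * (H + E) + 2 * (a k)\<^sup>2 / (1 - lam) * (H + E) = c * H + c * E"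
    by (simp only: c_def distrib_left distrib_right)
  moreover have "c * E = (2 * L / (1 - lam)\<^sup>2 + 2 / (1 - lam)) * ((a k)\<^sup>2 * E)"
    by (simp add: c_def b_def power_divide algebra_simps)
  ultimately have "f (z (Suc k)) + (norm (m (Suc k)))\<^sup>2
      \<le> f (z k) + lam * (norm (m k))\<^sup>2 + b * (gradient f (z k) \<bullet> e k) + b / 4 * (G + H)
        + (2 * L / (1 - lam)\<^sup>2 + 2 / (1 - lam)) * ((a k)\<^sup>2 * E) - b * P"
    by linarith
  with inner show ?thesis
    unfolding G_def[symmetric] H_def[symmetric] E_def[symmetric] by (simp add: algebra_simps) argo
qed

lemma eventually_steps_small:
  "\<forall>\<^sub>F k in sequentially.
     a k / (1 - lam) * (L\<^sup>2 * (nu - lam / (1 - lam))\<^sup>2) \<le> 1 - lam \<and>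
     2 * L * (a k / (1 - lam))\<^sup>2 + 2 * (a k)\<^sup>2 / (1 - lam) \<le> a k / (1 - lam) / 4"
proof -
  have "(\<lambda>k. a k / (1 - lam) * (L\<^sup>2 * (nu - lam / (1 - lam))\<^sup>2)) \<longlonglongrightarrow> 0"
    using tendsto_mult_right[OF step_tendsto_0,
        of "L\<^sup>2 * (nu - lam / (1 - lam))\<^sup>2 / (1 - lam)"]
    by (simp add: divide_inverse ac_simps)
  then have "\<forall>\<^sub>F k in sequentially. a k / (1 - lam) * (L\<^sup>2 * (nu - lam / (1 - lam))\<^sup>2) < 1 - lam"
    by (rule order_tendstoD) (use lam_less_1 in simp)
  moreover have "(\<lambda>k. a k * (2 * L / (1 - lam) + 2)) \<longlonglongrightarrow> 0"
    using tendsto_mult_right[OF step_tendsto_0, of "2 * L / (1 - lam) + 2"] by simp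
  then have "\<forall>\<^sub>F k in sequentially. a k * (2 * L / (1 - lam) + 2) < 1 / 4"
    by (intro order_tendstoD) auto
  then have "\<forall>\<^sub>F k in sequentially.
      2 * L * (a k / (1 - lam))\<^sup>2 + 2 * (a k)\<^sup>2 / (1 - lam) \<le> a k / (1 - lam) / 4"
  proof eventually_elim
    case (elim k)
    have "2 * L * (a k / (1 - lam))\<^sup>2 + 2 * (a k)\<^sup>2 / (1 - lam)
        = a k / (1 - lam) * (a k * (2 * L / (1 - lam) + 2))"
      by (simp add: power2_eq_square algebra_simps)
    also have "\<dots> \<le> a k / (1 - lam) * (1 / 4)"
      using elim step_pos[of k] lam_less_1 by (intro mult_left_mono) auto
    finally show ?case
      by simp
  qed
  ultimately show ?thesis
    by eventually_elim simp
qed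

end

text \<open>
  The trajectories for which the noise is harmless; almost all trajectories of the stochastic
  method will turn out to be of this kind.
\<close>

locale tame_momentum_path = momentum_path +
  assumes gradient_z_summable: "summable (\<lambda>k. a k * (norm (gradient f (z k)))\<^sup>2)"
    and gradient_q_summable: "summable (\<lambda>k. a k * (norm (gradient f (q k)))\<^sup>2)"
    and momentum_summable: "summable (\<lambda>k. (norm (m k))\<^sup>2)"
    and noise_summable: "summable (\<lambda>k. a k *\<^sub>R e k)"
    and noise_square_summable: "summable (\<lambda>k. (a k)\<^sup>2 * (norm (e k))\<^sup>2)"
    and noise_gradient_summable: "summable (\<lambda>k. a k * (gradient f (z k) \<bullet> e k))"
begin

lemma momentum_tendsto_0: "m \<longlonglongrightarrow> 0"
  using summable_LIMSEQ_zero[OF momentum_summable]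
  by (simp add: tendsto_power_zero tendsto_norm_zero_iff)

lemma y_minus_z_tendsto_0: "(\<lambda>k. norm (y k - z k)) \<longlonglongrightarrow> 0"
  using tendsto_mult_right_zero[OF tendsto_norm_zero[OF momentum_tendsto_0], of "\<bar>lam / (1 - lam)\<bar>"]
  by (simp add: z_eq)

text \<open>
  The increments of \<open>f (z k)\<close> form a convergent series: the drift and the second-order
  error converge absolutely, and the fluctuations converge by assumption.
\<close>

lemma objective_z_convergent: "convergent (\<lambda>k. f (z k))"
proof -
  define b where "b k = a k / (1 - lam)" for k
  define r where "r k = f (z (Suc k)) - f (z k) + b k * (gradient f (z k) \<bullet> gradient f (q k))
     - b k * (gradient f (z k) \<bullet> e k)" for k
  have "summable r"
  proof (rule summable_comparison_test')
    show "summable (\<lambda>k. 2 * L / (1 - lam)\<^sup>2 *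
        (a 0 * (a k * (norm (gradient f (q k)))\<^sup>2) + (a k)\<^sup>2 * (norm (e k))\<^sup>2))"
      by (intro summable_mult summable_add gradient_q_summable noise_square_summable)
    fix k
    have "norm (r k) \<le> 2 * L * (b k)\<^sup>2 * ((norm (gradient f (q k)))\<^sup>2 + (norm (e k))\<^sup>2)"
      using objective_increment[of k] by (simp add: r_def b_def)
    also have "\<dots> = 2 * L / (1 - lam)\<^sup>2 *
        ((a k * a k) * (norm (gradient f (q k)))\<^sup>2 + (a k)\<^sup>2 * (norm (e k))\<^sup>2)"
      by (simp add: b_def power_divide) (simp add: power2_eq_square distrib_left)
    also have "\<dots> \<le> 2 * L / (1 - lam)\<^sup>2 *
        ((a 0 * a k) * (norm (gradient f (q k)))\<^sup>2 + (a k)\<^sup>2 * (norm (e k))\<^sup>2)"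
      using L_pos step_pos[of k] step_le_first[of k]
      by (intro mult_left_mono add_right_mono mult_right_mono) auto
    finally show "norm (r k) \<le> 2 * L / (1 - lam)\<^sup>2 *
        (a 0 * (a k * (norm (gradient f (q k)))\<^sup>2) + (a k)\<^sup>2 * (norm (e k))\<^sup>2)"
      by (simp only: mult.assoc)
  qed
  moreover have "summable (\<lambda>k. a k * (gradient f (z k) \<bullet> gradient f (q k)))"
  proof (rule summable_comparison_test')
    show "summable (\<lambda>k. a k * (norm (gradient f (z k)))\<^sup>2 + a k * (norm (gradient f (q k)))\<^sup>2)"
      by (intro summable_add gradient_z_summable gradient_q_summable)
    fix k
    define G where "G = norm (gradient f (z k))"
    define H where "H = norm (gradient f (q k))"
    have "\<bar>gradient f (z k) \<bullet> gradient f (q k)\<bar> \<le> G * H"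
      unfolding G_def H_def by (rule Cauchy_Schwarz_ineq2)
    also have "\<dots> \<le> G\<^sup>2 + H\<^sup>2"
    proof -
      have "2 * G * H \<le> G\<^sup>2 + H\<^sup>2" and "0 \<le> G * H"
        using sum_squares_bound[of G H] by (auto simp: G_def H_def)
      then show ?thesis by linarith
    qed
    finally have "a k * \<bar>gradient f (z k) \<bullet> gradient f (q k)\<bar> \<le> a k * (G\<^sup>2 + H\<^sup>2)"
      using step_pos[of k] by simp
    then show "norm (a k * (gradient f (z k) \<bullet> gradient f (q k)))
        \<le> a k * (norm (gradient f (z k)))\<^sup>2 + a k * (norm (gradient f (q k)))\<^sup>2"
      using step_pos[of k] by (simp add: abs_mult G_def H_def distrib_left)
  qed
  ultimately have "summable (\<lambda>k. r k - a k * (gradient f (z k) \<bullet> gradient f (q k)) / (1 - lam)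
      + a k * (gradient f (z k) \<bullet> e k) / (1 - lam))"
    by (intro summable_add summable_diff summable_divide noise_gradient_summable)
  then have "summable (\<lambda>k. f (z (Suc k)) - f (z k))"
    by (simp add: r_def b_def)
  then have "convergent (\<lambda>n. f (z n) - f (z 0))"
    by (simp only: summable_iff_convergent sum_lessThan_telescope[of "\<lambda>k. f (z k)"])
  then show ?thesis
    using convergent_diff_const_right_iff[of "\<lambda>n. f (z n)" "f (z 0)"] by simp
qed

text \<open>
  Over windows of bounded length in the step-size clock the \<open>z\<close> path hardly moves: the noise
  contributes a Cauchy block. If \<open>G\<close> is the length of the gradient at \<open>q k\<close>, then
  \<open>G \<le> h + G\<^sup>2 / h\<close>, which bounds the drift by a small multiple of the window length
  plus a block of a convergent series.
\<close>

lemma z_window_small: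
  assumes "\<epsilon> > 0"
  shows "\<forall>\<^sub>F s in sequentially. \<forall>t\<ge>s. (\<Sum>k=s..<t. a k) \<le> C \<longrightarrow> norm (z t - z s) < \<epsilon>"
proof -
  define \<delta> where "\<delta> = \<epsilon> * (1 - lam)"
  \<comment> \<open>chosen such that a window of clock length \<open>C\<close> has \<open>h * C \<le> \<delta> / 3\<close>\<close>
  define h where "h = \<delta> / (3 * (\<bar>C\<bar> + 1))"
  have \<delta>: "\<delta> > 0" and h: "h > 0"
    using assms lam_less_1 by (auto simp: \<delta>_def h_def)
  obtain N1 where N1: "\<And>s t. s \<ge> N1 \<Longrightarrow> norm (\<Sum>k=s..<t. a k *\<^sub>R e k) < \<delta> / 3"
    using noise_summable \<delta> unfolding summable_Cauchy by (meson zero_less_divide_iff zero_less_numeral)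
  obtain N2 where N2: "\<And>s t. s \<ge> N2 \<Longrightarrow>
      norm (\<Sum>k=s..<t. a k * (norm (gradient f (q k)))\<^sup>2) < h * \<delta> / 3"
    using gradient_q_summable \<delta> h unfolding summable_Cauchy
    by (meson mult_pos_pos zero_less_divide_iff zero_less_numeral)
  have "norm (z t - z s) < \<epsilon>"
    if s: "s \<ge> max N1 N2" and t: "t \<ge> s" and C: "(\<Sum>k=s..<t. a k) \<le> C" for s t
  proof -
    have "z t - z s = (\<Sum>k=s..<t. z (Suc k) - z k)"
      using t by (simp add: sum_Suc_diff')
    also have "\<dots> = (\<Sum>k=s..<t. (1 / (1 - lam)) *\<^sub>R (a k *\<^sub>R e k - a k *\<^sub>R gradient f (q k)))"
      by (intro sum.cong) (simp_all add: z_Suc scaleR_diff_right)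
    also have "\<dots> = (1 / (1 - lam)) *\<^sub>R
        ((\<Sum>k=s..<t. a k *\<^sub>R e k) - (\<Sum>k=s..<t. a k *\<^sub>R gradient f (q k)))"
      by (simp only: scaleR_sum_right[symmetric] sum_subtractf)
    finally have "norm (z t - z s) = 1 / (1 - lam) *
        norm ((\<Sum>k=s..<t. a k *\<^sub>R e k) - (\<Sum>k=s..<t. a k *\<^sub>R gradient f (q k)))"
      using lam_less_1 by simp
    moreover have "norm (\<Sum>k=s..<t. a k *\<^sub>R gradient f (q k)) \<le> 2 * \<delta> / 3"
    proof -
      have "norm (\<Sum>k=s..<t. a k *\<^sub>R gradient f (q k))
          \<le> (\<Sum>k=s..<t. h * a k + a k * (norm (gradient f (q k)))\<^sup>2 / h)"
      proof (rule sum_norm_le)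
        fix k
        define G where "G = norm (gradient f (q k))"
        have "G \<le> h + G\<^sup>2 / h"
        proof (cases "G \<le> h")
          case False
          then have "G * h \<le> G * G"
            using h by (intro mult_left_mono) auto
          then have "G \<le> G\<^sup>2 / h"
            using h by (simp add: field_simps power2_eq_square)
          with h show ?thesis by simp
        qed (use h in \<open>simp add: add_increasing2\<close>)
        then have "a k * G \<le> a k * (h + G\<^sup>2 / h)"
          using step_pos[of k] by simp
        then show "norm (a k *\<^sub>R gradient f (q k))
            \<le> h * a k + a k * (norm (gradient f (q k)))\<^sup>2 / h"
          using step_pos[of k] by (simp add: G_def algebra_simps)
      qed
      also have "\<dots> = h * (\<Sum>k=s..<t. a k) + (\<Sum>k=s..<t. a k * (norm (gradient f (q k)))\<^sup>2) / h"
        by (simp add: sum.distrib sum_distrib_left sum_divide_distrib)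
      also have "\<dots> \<le> \<delta> / 3 + \<delta> / 3"
      proof (rule add_mono)
        have "h * (\<Sum>k=s..<t. a k) \<le> h * (\<bar>C\<bar> + 1)"
          using C h by (intro mult_left_mono) auto
        also have "\<dots> = \<delta> / 3"
          by (simp add: h_def field_simps)
        finally show "h * (\<Sum>k=s..<t. a k) \<le> \<delta> / 3" .
        have "(\<Sum>k=s..<t. a k * (norm (gradient f (q k)))\<^sup>2) \<le> h * \<delta> / 3"
          using N2[of s t] s by auto
        then show "(\<Sum>k=s..<t. a k * (norm (gradient f (q k)))\<^sup>2) / h \<le> \<delta> / 3"
          using h by (simp add: field_simps)
      qed
      finally show ?thesis
        by simp
    qed
    then have "norm ((\<Sum>k=s..<t. a k *\<^sub>R e k) - (\<Sum>k=s..<t. a k *\<^sub>R gradient f (q k))) < \<delta>"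
      using N1[of s t] s
        norm_triangle_ineq4[of "\<Sum>k=s..<t. a k *\<^sub>R e k" "\<Sum>k=s..<t. a k *\<^sub>R gradient f (q k)"]
      by linarith
    ultimately have "norm (z t - z s) < 1 / (1 - lam) * \<delta>"
      using lam_less_1 by (simp add: divide_strict_right_mono)
    then show ?thesis
      using lam_less_1 by (simp add: \<delta>_def)
  qed
  then show ?thesis
    by (intro eventually_sequentiallyI[of "max N1 N2"]) blast
qed

lemma y_window_small:
  assumes "\<epsilon> > 0"
  shows "\<forall>\<^sub>F s in sequentially. \<forall>t\<ge>s. (\<Sum>k=s..<t. a k) \<le> C \<longrightarrow> norm (y t - y s) < \<epsilon>"
proof -
  have "\<forall>\<^sub>F k in sequentially. norm (y k - z k) < \<epsilon> / 3"
    using y_minus_z_tendsto_0 assms by (intro order_tendstoD) auto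
  then have "\<forall>\<^sub>F s in sequentially. \<forall>t\<ge>s. norm (y t - z t) < \<epsilon> / 3"
    by (simp add: eventually_all_ge_at_top)
  moreover have "\<forall>\<^sub>F s in sequentially. \<forall>t\<ge>s. (\<Sum>k=s..<t. a k) \<le> C \<longrightarrow> norm (z t - z s) < \<epsilon> / 3"
    using assms by (intro z_window_small) simp
  ultimately show ?thesis
  proof eventually_elim
    case (elim s)
    show ?case
    proof (intro allI impI)
      fix t assume t: "s \<le> t" "(\<Sum>k=s..<t. a k) \<le> C"
      have "y t - y s = (y t - z t) + (z t - z s) - (y s - z s)"
        by simp
      also have "norm \<dots> \<le> norm (y t - z t) + norm (z t - z s) + norm (y s - z s)"
        by (meson norm_triangle_ineq norm_triangle_ineq4 add_right_mono order_trans)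
      also have "\<dots> < \<epsilon>"
      proof -
        have "norm (y t - z t) < \<epsilon> / 3" "norm (y s - z s) < \<epsilon> / 3" "norm (z t - z s) < \<epsilon> / 3"
          using elim t by auto
        then show ?thesis by linarith
      qed
      finally show "norm (y t - y s) < \<epsilon>" .
    qed
  qed
qed

text \<open>
  Every window of clock length \<open>1\<close> contains a point with small gradient, as otherwise the
  gradient series would collect a fixed amount on it; and the window is too short for the gradient
  to have changed much between its start and that point.
\<close>

lemma gradient_z_tendsto_0: "(\<lambda>k. norm (gradient f (z k))) \<longlonglongrightarrow> 0"
proof (rule order_tendstoI)
  fix \<epsilon> :: real assume \<epsilon>: "0 < \<epsilon>"
  obtain N where N: "\<And>s t. s \<ge> N \<Longrightarrow>
      norm (\<Sum>k=s..<t. a k * (norm (gradient f (z k)))\<^sup>2) < (\<epsilon> / 2)\<^sup>2"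
    using gradient_z_summable \<epsilon> unfolding summable_Cauchy
    by (metis half_gt_zero zero_less_power)
  have "\<forall>\<^sub>F s in sequentially. \<forall>t\<ge>s. (\<Sum>k=s..<t. a k) \<le> 1 \<longrightarrow> norm (z t - z s) < \<epsilon> / (2 * L)"
    using \<epsilon> L_pos by (intro z_window_small) simp
  then show "\<forall>\<^sub>F s in sequentially. norm (gradient f (z s)) < \<epsilon>"
    using eventually_ge_at_top[of N]
  proof eventually_elim
    case (elim s)
    define t where "t = (LEAST t. s \<le> t \<and> 1 < (\<Sum>k=s..<t. a k))"
    have t: "s \<le> t \<and> 1 < (\<Sum>k=s..<t. a k)"
      unfolding t_def by (rule LeastI_ex) (use step_sum_unbounded[of s 1] in blast)
    have "\<exists>j\<in>{s..<t}. norm (gradient f (z j)) < \<epsilon> / 2"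
    proof (rule ccontr)
      assume *: "\<not> ?thesis"
      have "1 * (\<epsilon> / 2)\<^sup>2 \<le> (\<Sum>k=s..<t. a k) * (\<epsilon> / 2)\<^sup>2"
        using t by (intro mult_right_mono) auto
      also have "\<dots> = (\<Sum>k=s..<t. a k * (\<epsilon> / 2)\<^sup>2)"
        by (simp add: sum_distrib_right)
      also have "\<dots> \<le> (\<Sum>k=s..<t. a k * (norm (gradient f (z k)))\<^sup>2)"
        using * \<epsilon> step_pos by (intro sum_mono mult_left_mono power_mono) (auto simp: not_less less_imp_le)
      finally show False
        using N[OF elim(2), of t] by simp
    qed
    then obtain j where j: "s \<le> j" "j < t" "norm (gradient f (z j)) < \<epsilon> / 2"
      by auto
    then have "(\<Sum>k=s..<j. a k) \<le> 1"
      using not_less_Least[of j "\<lambda>t. s \<le> t \<and> 1 < (\<Sum>k=s..<t. a k)"] by (auto simp: t_def)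
    with elim(1) j have "norm (z j - z s) < \<epsilon> / (2 * L)"
      by blast
    then have "L * norm (z s - z j) < \<epsilon> / 2"
      using L_pos by (simp add: field_simps norm_minus_commute)
    with gradient_dist[of "z s" "z j"]
    have "norm (gradient f (z s) - gradient f (z j)) < \<epsilon> / 2"
      by linarith
    then show ?case
      using j(3) norm_triangle_ineq2[of "gradient f (z s)" "gradient f (z j)"] by linarith
  qed
qed (simp add: eventually_sequentially less_le_trans)

lemma gradient_y_tendsto_0: "(\<lambda>k. norm (gradient f (y k))) \<longlonglongrightarrow> 0"
proof -
  have "(\<lambda>k. (gradient f (y k) - gradient f (z k)) + gradient f (z k)) \<longlonglongrightarrow> 0 + 0"
    using gradient_tendsto_diff[OF y_minus_z_tendsto_0] gradient_z_tendsto_0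
    by (intro tendsto_add) (auto simp: tendsto_norm_zero_iff)
  then show ?thesis
    by (simp add: tendsto_norm_zero)
qed

lemma objective_y_minus_z_tendsto_0: "(\<lambda>k. f (y k) - f (z k)) \<longlonglongrightarrow> 0"
proof (rule Lim_null_comparison)
  show "(\<lambda>k. norm (gradient f (z k)) * norm (y k - z k) + L * (norm (y k - z k))\<^sup>2) \<longlonglongrightarrow> 0"
    using tendsto_add[OF tendsto_mult[OF gradient_z_tendsto_0 y_minus_z_tendsto_0]
        tendsto_mult_left[OF tendsto_power[OF y_minus_z_tendsto_0, of 2], of L]]
    by simp
  have "norm (f (y k) - f (z k))
      \<le> norm (gradient f (z k)) * norm (y k - z k) + L * (norm (y k - z k))\<^sup>2" for k
    using first_order_error[of "y k" "z k"] Cauchy_Schwarz_ineq2[of "gradient f (z k)" "y k - z k"]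
    by simp
  then show "\<forall>\<^sub>F k in sequentially. norm (f (y k) - f (z k))
      \<le> norm (gradient f (z k)) * norm (y k - z k) + L * (norm (y k - z k))\<^sup>2"
    by simp
qed

end

section \<open>Series driven by martingale noise\<close>

lemma AE_summable_of_expectations:
  fixes g :: "nat \<Rightarrow> 'a \<Rightarrow> real"
  assumes int: "\<And>k. integrable M (g k)"
    and nonneg: "\<And>k \<omega>. 0 \<le> g k \<omega>"
    and sum: "summable (\<lambda>k. \<integral>\<omega>. g k \<omega> \<partial>M)"
  shows "AE \<omega> in M. summable (\<lambda>k. g k \<omega>)"
proof -
  have [measurable]: "g k \<in> borel_measurable M" for k
    using int by auto
  have "(\<integral>\<^sup>+\<omega>. (\<Sum>k. ennreal (g k \<omega>)) \<partial>M) = (\<Sum>k. ennreal (\<integral>\<omega>. g k \<omega> \<partial>M))"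
    by (simp only: nn_integral_eq_integral[OF int AE_I2[OF nonneg]] nn_integral_suminf
        borel_measurable_integrable[OF int] measurable_compose[OF _ measurable_ennreal])
  also have "\<dots> \<noteq> \<infinity>"
    unfolding suminf_ennreal2[OF Bochner_Integration.integral_nonneg[OF nonneg] sum] by simp
  finally have "AE \<omega> in M. (\<Sum>k. ennreal (g k \<omega>)) \<noteq> \<infinity>"
    by (intro nn_integral_PInf_AE) auto
  then show ?thesis
  proof eventually_elim
    case (elim \<omega>)
    then show ?case
      by (intro summable_suminf_not_top) (simp_all add: nonneg)
  qed
qed

text \<open>
  Here \<open>F k\<close> contains the information available before \<open>e k\<close> is drawn.
\<close>

locale martingale_noise = prob_space M for M :: "'a measure" +
  fixes F :: "nat \<Rightarrow> 'a measure" and e :: "nat \<Rightarrow> 'a \<Rightarrow> real ^ 'd" and \<sigma> :: real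
  assumes subalgebra: "subalgebra M (F k)"
    and filtration: "sets (F k) \<subseteq> sets (F (Suc k))"
    and noise_adapted: "e k \<in> borel_measurable (F (Suc k))"
    and noise_centered: "AE \<omega> in M. vec_cond_exp M (F k) (e k) \<omega> = 0"
    and noise_variance: "AE \<omega> in M.
      nn_cond_exp M (F k) (\<lambda>\<omega>'. ennreal ((norm (e k \<omega>'))\<^sup>2)) \<omega> \<le> ennreal (\<sigma>\<^sup>2)"
begin

lemma measurable_F_M: "g \<in> borel_measurable (F k) \<Longrightarrow> g \<in> borel_measurable M"
  by (rule measurable_from_subalg[OF subalgebra])

lemma space_F: "space (F k) = space M"
  using subalgebra[of k] by (simp add: subalgebra_def)

lemma measurable_F_mono:
  assumes "g \<in> borel_measurable (F j)" "j \<le> k"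
  shows "g \<in> borel_measurable (F k)"
proof -
  have "sets (F j) \<subseteq> sets (F k)"
    using filtration assms(2) by (rule lift_Suc_mono_le)
  then have "subalgebra (F k) (F j)"
    by (simp add: subalgebra_def space_F)
  then show ?thesis
    using assms(1) by (rule measurable_from_subalg)
qed

lemma noise_measurable [measurable]: "e k \<in> borel_measurable M"
  using noise_adapted by (rule measurable_F_M)

lemma cond_exp_locale: "sigma_finite_subalgebra M (F k)"
  by (intro finite_measure_subalgebra_is_sigma_finite)
    (simp add: finite_measure_subalgebra_def finite_measure_subalgebra_axioms_def subalgebra
      finite_measure_axioms)

lemma weighted_noise_nn_integral:
  assumes "g \<in> borel_measurable (F k)"
  shows "(\<integral>\<^sup>+\<omega>. g \<omega> * ennreal ((norm (e k \<omega>))\<^sup>2) \<partial>M) \<le> ennreal (\<sigma>\<^sup>2) * (\<integral>\<^sup>+\<omega>. g \<omega> \<partial>M)"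
proof -
  interpret S: sigma_finite_subalgebra M "F k"
    by (rule cond_exp_locale)
  have [measurable]: "g \<in> borel_measurable M"
    using assms by (rule measurable_F_M)
  have "(\<integral>\<^sup>+\<omega>. g \<omega> * ennreal ((norm (e k \<omega>))\<^sup>2) \<partial>M)
      = (\<integral>\<^sup>+\<omega>. g \<omega> * nn_cond_exp M (F k) (\<lambda>\<omega>'. ennreal ((norm (e k \<omega>'))\<^sup>2)) \<omega> \<partial>M)"
    using assms by (intro S.nn_cond_exp_intg[symmetric]) auto
  also have "\<dots> \<le> (\<integral>\<^sup>+\<omega>. g \<omega> * ennreal (\<sigma>\<^sup>2) \<partial>M)"
    by (intro nn_integral_mono_AE eventually_mono[OF noise_variance]) (auto intro: mult_left_mono)
  also have "\<dots> = ennreal (\<sigma>\<^sup>2) * (\<integral>\<^sup>+\<omega>. g \<omega> \<partial>M)"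
    by (simp add: nn_integral_multc mult.commute)
  finally show ?thesis .
qed

lemma
  fixes Y :: "'a \<Rightarrow> 'b :: euclidean_space"
  assumes Y: "Y \<in> borel_measurable (F k)" and int: "integrable M (\<lambda>\<omega>. (norm (Y \<omega>))\<^sup>2)"
  shows weighted_noise_integrable: "integrable M (\<lambda>\<omega>. (norm (Y \<omega>))\<^sup>2 * (norm (e k \<omega>))\<^sup>2)"
    and weighted_noise_integral:
      "(\<integral>\<omega>. (norm (Y \<omega>))\<^sup>2 * (norm (e k \<omega>))\<^sup>2 \<partial>M) \<le> \<sigma>\<^sup>2 * (\<integral>\<omega>. (norm (Y \<omega>))\<^sup>2 \<partial>M)"
proof -
  have [measurable]: "Y \<in> borel_measurable M"
    using Y by (rule measurable_F_M)
  have "(\<integral>\<^sup>+\<omega>. ennreal ((norm (Y \<omega>))\<^sup>2 * (norm (e k \<omega>))\<^sup>2) \<partial>M)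
      = (\<integral>\<^sup>+\<omega>. ennreal ((norm (Y \<omega>))\<^sup>2) * ennreal ((norm (e k \<omega>))\<^sup>2) \<partial>M)"
    by (simp add: ennreal_mult)
  also have "\<dots> \<le> ennreal (\<sigma>\<^sup>2) * (\<integral>\<^sup>+\<omega>. ennreal ((norm (Y \<omega>))\<^sup>2) \<partial>M)"
    using Y by (intro weighted_noise_nn_integral) auto
  also have "\<dots> = ennreal (\<sigma>\<^sup>2 * (\<integral>\<omega>. (norm (Y \<omega>))\<^sup>2 \<partial>M))"
    using int by (simp add: nn_integral_eq_integral ennreal_mult)
  finally have *: "(\<integral>\<^sup>+\<omega>. ennreal ((norm (Y \<omega>))\<^sup>2 * (norm (e k \<omega>))\<^sup>2) \<partial>M)
      \<le> ennreal (\<sigma>\<^sup>2 * (\<integral>\<omega>. (norm (Y \<omega>))\<^sup>2 \<partial>M))" .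
  show i: "integrable M (\<lambda>\<omega>. (norm (Y \<omega>))\<^sup>2 * (norm (e k \<omega>))\<^sup>2)"
    by (rule integrableI_bounded) (use * in \<open>auto simp: le_less_trans\<close>)
  show "(\<integral>\<omega>. (norm (Y \<omega>))\<^sup>2 * (norm (e k \<omega>))\<^sup>2 \<partial>M) \<le> \<sigma>\<^sup>2 * (\<integral>\<omega>. (norm (Y \<omega>))\<^sup>2 \<partial>M)"
    using * by (subst (asm) nn_integral_eq_integral[OF i]) auto
qed

lemma noise_square_integrable: "integrable M (\<lambda>\<omega>. (norm (e k \<omega>))\<^sup>2)"
  using weighted_noise_integrable[of "\<lambda>_. 1 :: real" k] by simp

lemma noise_square_integral: "(\<integral>\<omega>. (norm (e k \<omega>))\<^sup>2 \<partial>M) \<le> \<sigma>\<^sup>2"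
  using weighted_noise_integral[of "\<lambda>_. 1 :: real" k] by (simp add: prob_space)

lemma
  assumes Y: "Y \<in> borel_measurable (F k)" and int: "integrable M (\<lambda>\<omega>. (norm (Y \<omega>))\<^sup>2)"
  shows noise_inner_square_integrable: "integrable M (\<lambda>\<omega>. (Y \<omega> \<bullet> e k \<omega>)\<^sup>2)"
    and noise_inner_square_integral:
      "(\<integral>\<omega>. (Y \<omega> \<bullet> e k \<omega>)\<^sup>2 \<partial>M) \<le> \<sigma>\<^sup>2 * (\<integral>\<omega>. (norm (Y \<omega>))\<^sup>2 \<partial>M)"
proof -
  have [measurable]: "Y \<in> borel_measurable M"
    using Y by (rule measurable_F_M)
  have le: "(Y \<omega> \<bullet> e k \<omega>)\<^sup>2 \<le> (norm (Y \<omega>))\<^sup>2 * (norm (e k \<omega>))\<^sup>2" for \<omega>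
    using Cauchy_Schwarz_ineq[of "Y \<omega>" "e k \<omega>"] by (simp add: power2_norm_eq_inner)
  show i: "integrable M (\<lambda>\<omega>. (Y \<omega> \<bullet> e k \<omega>)\<^sup>2)"
    by (rule Bochner_Integration.integrable_bound[OF weighted_noise_integrable[OF Y int]])
      (use le in \<open>auto simp: abs_mult\<close>)
  have "(\<integral>\<omega>. (Y \<omega> \<bullet> e k \<omega>)\<^sup>2 \<partial>M) \<le> (\<integral>\<omega>. (norm (Y \<omega>))\<^sup>2 * (norm (e k \<omega>))\<^sup>2 \<partial>M)"
    by (intro integral_mono i weighted_noise_integrable[OF Y int] le)
  with weighted_noise_integral[OF Y int]
  show "(\<integral>\<omega>. (Y \<omega> \<bullet> e k \<omega>)\<^sup>2 \<partial>M) \<le> \<sigma>\<^sup>2 * (\<integral>\<omega>. (norm (Y \<omega>))\<^sup>2 \<partial>M)"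
    by linarith
qed

text \<open>
  This covers the cross terms of a squared noise sum, where \<open>S\<close> is the sum so far: the product
  of the square-integrable \<open>S\<close> and \<open>Y\<close> is in general merely integrable.
\<close>

lemma noise_inner_integral_0:
  fixes S :: "'a \<Rightarrow> real"
  assumes S: "S \<in> borel_measurable (F k)" and S2: "integrable M (\<lambda>\<omega>. (S \<omega>)\<^sup>2)"
    and Y: "Y \<in> borel_measurable (F k)" and Y2: "integrable M (\<lambda>\<omega>. (norm (Y \<omega>))\<^sup>2)"
  shows "integrable M (\<lambda>\<omega>. S \<omega> * (Y \<omega> \<bullet> e k \<omega>))"
    and "(\<integral>\<omega>. S \<omega> * (Y \<omega> \<bullet> e k \<omega>) \<partial>M) = 0"
proof -
  interpret S: sigma_finite_subalgebra M "F k"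
    by (rule cond_exp_locale)
  have [measurable]: "Y \<in> borel_measurable M" "S \<in> borel_measurable M"
    using Y S by (auto intro: measurable_F_M)
  have YF: "(\<lambda>\<omega>. S \<omega> * (Y \<omega> $ i)) \<in> borel_measurable (F k)" for i
    using S Y by (auto simp: cart_eq_inner_axis)
  have int: "integrable M (\<lambda>\<omega>. S \<omega> * (Y \<omega> $ i) * (e k \<omega> $ i))" for i
  proof (rule Bochner_Integration.integrable_bound)
    show "integrable M (\<lambda>\<omega>. (S \<omega>)\<^sup>2 + (norm (Y \<omega>))\<^sup>2 * (norm (e k \<omega>))\<^sup>2)"
      by (intro Bochner_Integration.integrable_add S2 weighted_noise_integrable Y Y2)
    have "\<bar>S \<omega> * (Y \<omega> $ i) * (e k \<omega> $ i)\<bar> \<le> (S \<omega>)\<^sup>2 + (norm (Y \<omega>))\<^sup>2 * (norm (e k \<omega>))\<^sup>2" for \<omega>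
    proof -
      define p where "p = norm (Y \<omega>) * norm (e k \<omega>)"
      have "\<bar>S \<omega> * (Y \<omega> $ i) * (e k \<omega> $ i)\<bar> = \<bar>S \<omega>\<bar> * (\<bar>Y \<omega> $ i\<bar> * \<bar>e k \<omega> $ i\<bar>)"
        by (simp add: abs_mult)
      also have "\<dots> \<le> \<bar>S \<omega>\<bar> * p"
        unfolding p_def by (intro mult_left_mono mult_mono component_le_norm_cart) auto
      also have "\<dots> \<le> (S \<omega>)\<^sup>2 + p\<^sup>2"
      proof -
        have "2 * \<bar>S \<omega>\<bar> * p \<le> (S \<omega>)\<^sup>2 + p\<^sup>2" and "0 \<le> \<bar>S \<omega>\<bar> * p"
          using sum_squares_bound[of "\<bar>S \<omega>\<bar>" p] by (auto simp: p_def)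
        then show ?thesis by linarith
      qed
      finally show ?thesis
        by (simp add: p_def power_mult_distrib)
    qed
    then show "AE \<omega> in M. norm (S \<omega> * (Y \<omega> $ i) * (e k \<omega> $ i))
        \<le> norm ((S \<omega>)\<^sup>2 + (norm (Y \<omega>))\<^sup>2 * (norm (e k \<omega>))\<^sup>2)"
      by (intro AE_I2) (auto intro: order_trans[OF _ abs_ge_self])
  qed (auto simp: cart_eq_inner_axis)
  have "(\<integral>\<omega>. S \<omega> * (Y \<omega> $ i) * (e k \<omega> $ i) \<partial>M) = 0" for i
  proof -
    have "(\<integral>\<omega>. S \<omega> * (Y \<omega> $ i) * (e k \<omega> $ i) \<partial>M)
        = (\<integral>\<omega>. S \<omega> * (Y \<omega> $ i) * real_cond_exp M (F k) (\<lambda>\<omega>. e k \<omega> $ i) \<omega> \<partial>M)"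
      using int YF by (intro S.real_cond_exp_intg(2)[symmetric]) (auto simp: cart_eq_inner_axis)
    also have "\<dots> = (\<integral>\<omega>. 0 \<partial>M)"
    proof (rule integral_cong_AE)
      show "AE \<omega> in M. S \<omega> * (Y \<omega> $ i) * real_cond_exp M (F k) (\<lambda>\<omega>. e k \<omega> $ i) \<omega> = 0"
        using noise_centered[of k] by eventually_elim (simp add: vec_cond_exp_def vec_eq_iff)
    qed (use measurable_F_M[OF YF] borel_measurable_cond_exp2 in auto)
    finally show ?thesis by simp
  qed
  moreover have eq: "(\<lambda>\<omega>. S \<omega> * (Y \<omega> \<bullet> e k \<omega>))
      = (\<lambda>\<omega>. \<Sum>i\<in>UNIV. S \<omega> * (Y \<omega> $ i) * (e k \<omega> $ i))"
    by (simp add: inner_vec_def sum_distrib_left mult.assoc)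
  ultimately show "(\<integral>\<omega>. S \<omega> * (Y \<omega> \<bullet> e k \<omega>) \<partial>M) = 0"
    by (simp add: int Bochner_Integration.integral_sum)
  show "integrable M (\<lambda>\<omega>. S \<omega> * (Y \<omega> \<bullet> e k \<omega>))"
    unfolding eq by (intro Bochner_Integration.integrable_sum int)
qed

definition predictable_L2 :: "(nat \<Rightarrow> 'a \<Rightarrow> real ^ 'd) \<Rightarrow> bool" where
  "predictable_L2 Y \<longleftrightarrow>
     (\<forall>k. Y k \<in> borel_measurable (F k) \<and> integrable M (\<lambda>\<omega>. (norm (Y k \<omega>))\<^sup>2))"

definition noise_sum :: "(nat \<Rightarrow> 'a \<Rightarrow> real ^ 'd) \<Rightarrow> nat \<Rightarrow> nat \<Rightarrow> 'a \<Rightarrow> real" where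
  "noise_sum Y s t \<omega> = (\<Sum>k=s..<t. Y k \<omega> \<bullet> e k \<omega>)"

lemma noise_sum_adapted:
  assumes "predictable_L2 Y"
  shows "noise_sum Y s t \<in> borel_measurable (F t)"
proof -
  have "Y k \<in> borel_measurable (F t)" "e k \<in> borel_measurable (F t)" if "k < t" for k
    using assms that noise_adapted[of k]
    by (auto simp: predictable_L2_def intro: measurable_F_mono[of _ k] measurable_F_mono[of _ "Suc k"])
  then show ?thesis
    unfolding noise_sum_def by (intro borel_measurable_sum borel_measurable_inner) auto
qed

text \<open>The terms of the sum are orthogonal, so their second moments add up.\<close>

lemma noise_sum_second_moment:
  assumes Y: "predictable_L2 Y" and "s \<le> t"
  shows "integrable M (\<lambda>\<omega>. (noise_sum Y s t \<omega>)\<^sup>2) \<and>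
    (\<integral>\<omega>. (noise_sum Y s t \<omega>)\<^sup>2 \<partial>M) \<le> \<sigma>\<^sup>2 * (\<Sum>k=s..<t. \<integral>\<omega>. (norm (Y k \<omega>))\<^sup>2 \<partial>M)"
  using \<open>s \<le> t\<close>
proof (induction t rule: dec_induct)
  case base
  show ?case by (simp add: noise_sum_def)
next
  case (step t)
  have Yt: "Y t \<in> borel_measurable (F t)" "integrable M (\<lambda>\<omega>. (norm (Y t \<omega>))\<^sup>2)"
    using Y by (auto simp: predictable_L2_def)
  note cross = noise_inner_integral_0[OF noise_sum_adapted[OF Y] conjunct1[OF step.IH] Yt]
  note diag = noise_inner_square_integrable[OF Yt] noise_inner_square_integral[OF Yt]
  have eq: "(noise_sum Y s (Suc t) \<omega>)\<^sup>2 = (noise_sum Y s t \<omega>)\<^sup>2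
      + (2 * (noise_sum Y s t \<omega> * (Y t \<omega> \<bullet> e t \<omega>)) + (Y t \<omega> \<bullet> e t \<omega>)\<^sup>2)" for \<omega>
    using step.hyps by (simp add: noise_sum_def power2_sum)
  have "integrable M (\<lambda>\<omega>. (noise_sum Y s (Suc t) \<omega>)\<^sup>2)"
    unfolding eq using step.IH cross(1) diag(1)
    by (intro Bochner_Integration.integrable_add integrable_mult_right) auto
  moreover have "(\<integral>\<omega>. (noise_sum Y s (Suc t) \<omega>)\<^sup>2 \<partial>M)
      = (\<integral>\<omega>. (noise_sum Y s t \<omega>)\<^sup>2 \<partial>M) + (\<integral>\<omega>. (Y t \<omega> \<bullet> e t \<omega>)\<^sup>2 \<partial>M)"
    unfolding eq using step.IH cross diag(1) by simp
  ultimately show ?case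
    using step diag(2) by (simp add: distrib_left)
qed

text \<open>
  Kolmogorov's maximal inequality. Setting the weights to zero once the sum has left the interval
  \<open>(- \<epsilon>, \<epsilon>)\<close> keeps them predictable and freezes the sum outside of it, so that the
  second moment of the frozen sum controls the probability of ever leaving.
\<close>

lemma noise_sum_maximal_inequality:
  assumes Y: "predictable_L2 Y" and \<epsilon>: "\<epsilon> > 0" and st: "s \<le> t"
  shows "prob {\<omega>\<in>space M. \<exists>j\<in>{s..t}. \<epsilon> \<le> \<bar>noise_sum Y s j \<omega>\<bar>}
    \<le> \<sigma>\<^sup>2 * (\<Sum>k=s..<t. \<integral>\<omega>. (norm (Y k \<omega>))\<^sup>2 \<partial>M) / \<epsilon>\<^sup>2"
proof -
  define A where "A k = {\<omega>\<in>space (F k). \<forall>j\<in>{s..k}. \<bar>noise_sum Y s j \<omega>\<bar> < \<epsilon>}" for k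
  define Y' where "Y' k \<omega> = indicator (A k) \<omega> *\<^sub>R Y k \<omega>" for k \<omega>
  have AF: "A k \<in> sets (F k)" for k
  proof -
    have [measurable]: "noise_sum Y s j \<in> borel_measurable (F k)" if "j \<in> {s..k}" for j
      using measurable_F_mono[OF noise_sum_adapted[OF Y]] that by simp
    show ?thesis
      unfolding A_def by measurable
  qed
  have Y'_le: "(norm (Y' k \<omega>))\<^sup>2 \<le> (norm (Y k \<omega>))\<^sup>2" for k \<omega>
    by (simp add: Y'_def indicator_def)
  have Y': "predictable_L2 Y'"
    unfolding predictable_L2_def
  proof (intro allI conjI)
    fix k
    have Yk: "Y k \<in> borel_measurable (F k)" "integrable M (\<lambda>\<omega>. (norm (Y k \<omega>))\<^sup>2)"
      using Y by (auto simp: predictable_L2_def)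
    show Y'k: "Y' k \<in> borel_measurable (F k)"
      unfolding Y'_def using AF[of k] Yk(1) by (intro borel_measurable_scaleR borel_measurable_indicator)
    show "integrable M (\<lambda>\<omega>. (norm (Y' k \<omega>))\<^sup>2)"
      by (rule Bochner_Integration.integrable_bound[OF Yk(2)])
        (use Y'_le measurable_F_M[OF Y'k] in auto)
  qed
  have [measurable]: "noise_sum Y s j \<in> borel_measurable M" "noise_sum Y' s j \<in> borel_measurable M" for j
    by (rule measurable_F_M[OF noise_sum_adapted[OF Y]], rule measurable_F_M[OF noise_sum_adapted[OF Y']])
  have frozen: "\<epsilon>\<^sup>2 \<le> (noise_sum Y' s t \<omega>)\<^sup>2"
    if \<omega>: "\<omega> \<in> space M" and j: "j \<in> {s..t}" "\<epsilon> \<le> \<bar>noise_sum Y s j \<omega>\<bar>" for \<omega> j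
  proof -
    define \<tau> where "\<tau> = (LEAST j. j \<in> {s..t} \<and> \<epsilon> \<le> \<bar>noise_sum Y s j \<omega>\<bar>)"
    have \<tau>: "\<tau> \<in> {s..t} \<and> \<epsilon> \<le> \<bar>noise_sum Y s \<tau> \<omega>\<bar>"
      unfolding \<tau>_def by (rule LeastI_ex) (use j in blast)
    have before: "\<bar>noise_sum Y s j \<omega>\<bar> < \<epsilon>" if "j < \<tau>" "s \<le> j" for j
      using not_less_Least[of j "\<lambda>j. j \<in> {s..t} \<and> \<epsilon> \<le> \<bar>noise_sum Y s j \<omega>\<bar>"] that \<tau>
      unfolding \<tau>_def[symmetric] by (auto simp: not_le)
    have "noise_sum Y' s t \<omega> = (\<Sum>k=s..<t. if k < \<tau> then Y k \<omega> \<bullet> e k \<omega> else 0)"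
      unfolding noise_sum_def
    proof (intro sum.cong refl)
      fix k assume k: "k \<in> {s..<t}"
      have "\<omega> \<in> A k \<longleftrightarrow> k < \<tau>"
      proof
        assume "\<omega> \<in> A k"
        then show "k < \<tau>"
          using \<tau> by (auto simp: A_def not_less[symmetric])
      next
        assume "k < \<tau>"
        then show "\<omega> \<in> A k"
          using before \<omega> by (auto simp: A_def space_F)
      qed
      then show "Y' k \<omega> \<bullet> e k \<omega> = (if k < \<tau> then Y k \<omega> \<bullet> e k \<omega> else 0)"
        by (simp add: Y'_def)
    qed
    also have "\<dots> = noise_sum Y s \<tau> \<omega>"
      unfolding noise_sum_def using \<tau> by (intro sum.mono_neutral_cong_right) auto
    finally have "\<epsilon> \<le> \<bar>noise_sum Y' s t \<omega>\<bar>"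
      using \<tau> by simp
    then show ?thesis
      using \<epsilon> by (simp add: abs_le_square_iff[symmetric])
  qed
  have "prob {\<omega>\<in>space M. \<exists>j\<in>{s..t}. \<epsilon> \<le> \<bar>noise_sum Y s j \<omega>\<bar>}
      \<le> prob {\<omega>\<in>space M. \<epsilon>\<^sup>2 \<le> (noise_sum Y' s t \<omega>)\<^sup>2}"
    by (rule finite_measure_mono) (use frozen in auto)
  also have "\<dots> \<le> (\<integral>\<omega>. (noise_sum Y' s t \<omega>)\<^sup>2 \<partial>M) / \<epsilon>\<^sup>2"
    using noise_sum_second_moment[OF Y' st] \<epsilon>
    by (intro integral_Markov_inequality_measure[where A = "{}"]) auto
  also have "\<dots> \<le> \<sigma>\<^sup>2 * (\<Sum>k=s..<t. \<integral>\<omega>. (norm (Y' k \<omega>))\<^sup>2 \<partial>M) / \<epsilon>\<^sup>2"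
    using noise_sum_second_moment[OF Y' st] by (intro divide_right_mono) auto
  also have "\<dots> \<le> \<sigma>\<^sup>2 * (\<Sum>k=s..<t. \<integral>\<omega>. (norm (Y k \<omega>))\<^sup>2 \<partial>M) / \<epsilon>\<^sup>2"
    using Y Y' Y'_le
    by (intro divide_right_mono mult_left_mono sum_mono integral_mono) (auto simp: predictable_L2_def)
  finally show ?thesis .
qed

text \<open>
  Letting \<open>t\<close> tend to infinity in the maximal inequality bounds the probability of ever exceeding
  \<open>\<epsilon>\<close> after time \<open>s\<close> by a tail \<open>R s\<close> of a convergent series.
\<close>

lemma AE_noise_sum_eventually_small:
  assumes Y: "predictable_L2 Y" and \<epsilon>: "\<epsilon> > 0"
    and sum: "summable (\<lambda>k. \<integral>\<omega>. (norm (Y k \<omega>))\<^sup>2 \<partial>M)"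
  shows "AE \<omega> in M. \<exists>s. \<forall>t\<ge>s. \<bar>noise_sum Y s t \<omega>\<bar> < \<epsilon>"
proof -
  define c where "c k = (\<integral>\<omega>. (norm (Y k \<omega>))\<^sup>2 \<partial>M)" for k
  define B where "B s = {\<omega>\<in>space M. \<exists>t\<ge>s. \<epsilon> \<le> \<bar>noise_sum Y s t \<omega>\<bar>}" for s
  define R where "R s = suminf c - (\<Sum>k<s. c k)" for s
  have c: "c k \<ge> 0" "summable c" for k
    using sum by (auto simp: c_def[abs_def])
  have [measurable]: "noise_sum Y s t \<in> borel_measurable M" for s t
    using noise_sum_adapted[OF Y] by (rule measurable_F_M)
  have B_meas [measurable]: "B s \<in> sets M" for s
    unfolding B_def by measurable
  have B_le: "prob (B s) \<le> \<sigma>\<^sup>2 * R s / \<epsilon>\<^sup>2" for s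
  proof (rule LIMSEQ_le_const2)
    let ?Bt = "\<lambda>t. {\<omega>\<in>space M. \<exists>j\<in>{s..t}. \<epsilon> \<le> \<bar>noise_sum Y s j \<omega>\<bar>}"
    have "(\<lambda>t. prob (?Bt t)) \<longlonglongrightarrow> prob (\<Union>t. ?Bt t)"
      by (rule finite_Lim_measure_incseq) (force simp: incseq_def)+
    also have "(\<Union>t. ?Bt t) = B s"
      unfolding B_def by (auto simp: Bex_def)
    finally show "(\<lambda>t. prob (?Bt t)) \<longlonglongrightarrow> prob (B s)" .
    have "prob (?Bt t) \<le> \<sigma>\<^sup>2 * R s / \<epsilon>\<^sup>2" if "t \<ge> s" for t
    proof -
      have "prob (?Bt t) \<le> \<sigma>\<^sup>2 * (\<Sum>k=s..<t. c k) / \<epsilon>\<^sup>2"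
        unfolding c_def by (rule noise_sum_maximal_inequality[OF Y \<epsilon> that])
      also have "(\<Sum>k=s..<t. c k) = (\<Sum>k<t. c k) - (\<Sum>k<s. c k)"
        using sum_diff_nat_ivl[of 0 s t c] that by (simp add: lessThan_atLeast0)
      also have "\<sigma>\<^sup>2 * \<dots> / \<epsilon>\<^sup>2 \<le> \<sigma>\<^sup>2 * R s / \<epsilon>\<^sup>2"
        unfolding R_def using c sum_le_suminf[of c "{..<t}"]
        by (intro divide_right_mono mult_left_mono diff_right_mono) auto
      finally show ?thesis .
    qed
    then show "\<exists>N. \<forall>t\<ge>N. prob (?Bt t) \<le> \<sigma>\<^sup>2 * R s / \<epsilon>\<^sup>2"
      by blast
  qed
  have "R \<longlonglongrightarrow> suminf c - suminf c"
    unfolding R_def using c by (intro tendsto_diff tendsto_const summable_LIMSEQ)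
  then have "(\<lambda>s. \<sigma>\<^sup>2 * R s / \<epsilon>\<^sup>2) \<longlonglongrightarrow> 0"
    using tendsto_mult_left[of R 0 sequentially "\<sigma>\<^sup>2 / \<epsilon>\<^sup>2"] by simp
  then have "prob (\<Inter>s. B s) \<le> 0"
  proof (rule LIMSEQ_le_const)
    have "prob (\<Inter>s. B s) \<le> prob (B s)" for s
      by (intro finite_measure_mono) auto
    then show "\<exists>N. \<forall>s\<ge>N. prob (\<Inter>s. B s) \<le> \<sigma>\<^sup>2 * R s / \<epsilon>\<^sup>2"
      using B_le by (meson order_trans)
  qed
  then have "(\<Inter>s. B s) \<in> null_sets M"
    by (auto simp: null_sets_def emeasure_eq_measure measure_le_0_iff)
  then show ?thesis
    by (rule AE_I') (auto simp: B_def not_less)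
qed

theorem AE_noise_series_summable:
  assumes Y: "predictable_L2 Y"
    and sum: "summable (\<lambda>k. \<integral>\<omega>. (norm (Y k \<omega>))\<^sup>2 \<partial>M)"
  shows "AE \<omega> in M. summable (\<lambda>k. Y k \<omega> \<bullet> e k \<omega>)"
proof -
  have "AE \<omega> in M. \<forall>n. \<exists>s. \<forall>t\<ge>s. \<bar>noise_sum Y s t \<omega>\<bar> < inverse (real (Suc n))"
    unfolding AE_all_countable by (intro allI AE_noise_sum_eventually_small[OF Y _ sum]) simp
  then show ?thesis
  proof eventually_elim
    case (elim \<omega>)
    show ?case
      unfolding summable_Cauchy
    proof (intro allI impI)
      fix \<epsilon> :: real assume "0 < \<epsilon>"
      then obtain n where n: "inverse (real (Suc n)) < \<epsilon> / 2"
        using reals_Archimedean[of "\<epsilon> / 2"] by auto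
      obtain N where N: "\<And>t. t \<ge> N \<Longrightarrow> \<bar>noise_sum Y N t \<omega>\<bar> < inverse (real (Suc n))"
        using elim by blast
      have "norm (\<Sum>k=s..<t. Y k \<omega> \<bullet> e k \<omega>) < \<epsilon>" if s: "s \<ge> N" for s t
      proof (cases "s \<le> t")
        case True
        then have "(\<Sum>k=s..<t. Y k \<omega> \<bullet> e k \<omega>) = noise_sum Y N t \<omega> - noise_sum Y N s \<omega>"
          unfolding noise_sum_def using s by (simp add: sum_diff_nat_ivl)
        then show ?thesis
          using N[OF s] N[OF order_trans[OF s True]] n unfolding real_norm_def by linarith
      qed (use \<open>0 < \<epsilon>\<close> in simp)
      then show "\<exists>N. \<forall>m\<ge>N. \<forall>n. norm (\<Sum>k=m..<n. Y k \<omega> \<bullet> e k \<omega>) < \<epsilon>"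
        by blast
    qed
  qed
qed

end

section \<open>Almost every trajectory is tame\<close>

text \<open>
  The energy argument integrates \<open>f (z k)\<close>, which grows at most quadratically in \<open>z k\<close>; so
  every iterate must be shown to have a finite second moment.
\<close>

definition square_integrable :: "'a measure \<Rightarrow> ('a \<Rightarrow> 'b :: euclidean_space) \<Rightarrow> bool" where
  "square_integrable M X \<longleftrightarrow> X \<in> borel_measurable M \<and> integrable M (\<lambda>\<omega>. (norm (X \<omega>))\<^sup>2)"

lemma square_integrable_bound:
  assumes "integrable M g" "X \<in> borel_measurable M"
    and "\<And>\<omega>. \<omega> \<in> space M \<Longrightarrow> (norm (X \<omega>))\<^sup>2 \<le> g \<omega>"
  shows "square_integrable M X"
  unfolding square_integrable_def
proof
  show "integrable M (\<lambda>\<omega>. (norm (X \<omega>))\<^sup>2)"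
  proof (rule Bochner_Integration.integrable_bound[OF assms(1)])
    show "AE \<omega> in M. norm ((norm (X \<omega>))\<^sup>2) \<le> norm (g \<omega>)"
      using assms(3) by (intro AE_I2) (simp add: order_trans[OF _ abs_ge_self])
  qed (use assms(2) in simp)
qed (rule assms(2))

lemma square_integrable_scaleR:
  assumes "square_integrable M X"
  shows "square_integrable M (\<lambda>\<omega>. c *\<^sub>R X \<omega>)"
  using assms by (auto simp: square_integrable_def power_mult_distrib)

lemma square_integrable_diff:
  assumes "square_integrable M X" "square_integrable M Y"
  shows "square_integrable M (\<lambda>\<omega>. X \<omega> - Y \<omega>)"
proof (rule square_integrable_bound)
  show "integrable M (\<lambda>\<omega>. 2 * ((norm (X \<omega>))\<^sup>2 + (norm (Y \<omega>))\<^sup>2))"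
    using assms by (auto simp: square_integrable_def)
qed (use assms norm_diff_square_le in \<open>simp_all only: square_integrable_def borel_measurable_diff\<close>)

lemma square_integrable_add:
  assumes "square_integrable M X" "square_integrable M Y"
  shows "square_integrable M (\<lambda>\<omega>. X \<omega> + Y \<omega>)"
  using square_integrable_diff[OF assms(1) square_integrable_scaleR[OF assms(2), of "-1"]] by simp

lemma (in smooth_objective) square_integrable_gradient:
  assumes "finite_measure M" and X: "square_integrable M X"
  shows "square_integrable M (\<lambda>\<omega>. gradient f (X \<omega>))"
proof (rule square_integrable_bound)
  interpret finite_measure M by fact
  have [measurable]: "X \<in> borel_measurable M"
    using X by (simp add: square_integrable_def)
  show "(\<lambda>\<omega>. gradient f (X \<omega>)) \<in> borel_measurable M"
    by measurable
  show "integrable M (\<lambda>\<omega>. 2 * (L\<^sup>2 * (norm (X \<omega>))\<^sup>2 + (norm (gradient f 0))\<^sup>2))"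
    using X by (auto simp: square_integrable_def)
  fix \<omega>
  have "(norm (gradient f (X \<omega>)))\<^sup>2 = (norm ((gradient f (X \<omega>) - gradient f 0) - (- gradient f 0)))\<^sup>2"
    by simp
  also have "\<dots> \<le> 2 * ((norm (gradient f (X \<omega>) - gradient f 0))\<^sup>2 + (norm (gradient f 0))\<^sup>2)"
    using norm_diff_square_le[of "gradient f (X \<omega>) - gradient f 0" "- gradient f 0"] by simp
  also have "(norm (gradient f (X \<omega>) - gradient f 0))\<^sup>2 \<le> (L * norm (X \<omega>))\<^sup>2"
    using gradient_dist[of "X \<omega>" 0] by (intro power_mono) auto
  finally show "(norm (gradient f (X \<omega>)))\<^sup>2 \<le> 2 * (L\<^sup>2 * (norm (X \<omega>))\<^sup>2 + (norm (gradient f 0))\<^sup>2)"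
    by (simp add: power_mult_distrib)
qed

lemma (in smooth_objective) integrable_objective:
  assumes "finite_measure M" and X: "square_integrable M X"
  shows "integrable M (\<lambda>\<omega>. f (X \<omega>))"
proof -
  interpret finite_measure M by fact
  have [measurable]: "X \<in> borel_measurable M"
    using X by (simp add: square_integrable_def)
  have bound: "\<bar>f (X \<omega>)\<bar> \<le> \<bar>f 0\<bar> + (norm (gradient f 0))\<^sup>2 + (1 + L) * (norm (X \<omega>))\<^sup>2" for \<omega>
  proof -
    define p where "p = norm (gradient f 0) * norm (X \<omega>)"
    have "2 * p \<le> (norm (gradient f 0))\<^sup>2 + (norm (X \<omega>))\<^sup>2" "0 \<le> p"
      using sum_squares_bound[of "norm (gradient f 0)" "norm (X \<omega>)"] by (auto simp: p_def)
    moreover have "\<bar>gradient f 0 \<bullet> X \<omega>\<bar> \<le> p"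
      unfolding p_def by (rule Cauchy_Schwarz_ineq2)
    moreover have "\<bar>f (X \<omega>) - f 0 - gradient f 0 \<bullet> X \<omega>\<bar> \<le> L * (norm (X \<omega>))\<^sup>2"
      using first_order_error[of "X \<omega>" 0] by simp
    ultimately show ?thesis
      unfolding distrib_right by linarith
  qed
  show ?thesis
  proof (rule Bochner_Integration.integrable_bound)
    show "integrable M (\<lambda>\<omega>. \<bar>f 0\<bar> + (norm (gradient f 0))\<^sup>2 + (1 + L) * (norm (X \<omega>))\<^sup>2)"
      using X by (auto simp: square_integrable_def)
    show "AE \<omega> in M. norm (f (X \<omega>))
        \<le> norm (\<bar>f 0\<bar> + (norm (gradient f 0))\<^sup>2 + (1 + L) * (norm (X \<omega>))\<^sup>2)"
      using bound by (intro AE_I2) (simp add: order_trans[OF _ abs_ge_self])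
  qed simp
qed

locale stochastic_momentum =
  smooth_objective f L + step_sizes a + martingale_noise M F e \<sigma>
  for f :: "real ^ 'd \<Rightarrow> real" and L :: real and a :: "nat \<Rightarrow> real" and M :: "'a measure"
    and F :: "nat \<Rightarrow> 'a measure" and e :: "nat \<Rightarrow> 'a \<Rightarrow> real ^ 'd" and \<sigma> :: real +
  fixes lam nu :: real and y m q z :: "nat \<Rightarrow> 'a \<Rightarrow> real ^ 'd"
  assumes bounded_below: "bdd_below (range f)"
    and path: "\<omega> \<in> space M \<Longrightarrow> momentum_path f L a lam nu
      (\<lambda>k. y k \<omega>) (\<lambda>k. m k \<omega>) (\<lambda>k. q k \<omega>) (\<lambda>k. z k \<omega>) (\<lambda>k. e k \<omega>)"
    and y_adapted: "y k \<in> borel_measurable (F k)" and m_adapted: "m k \<in> borel_measurable (F k)"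
    and y_0: "square_integrable M (y 0)" and m_0: "square_integrable M (m 0)"
begin

lemma lam_nonneg: "0 \<le> lam" and lam_less_1: "lam < 1"
  using not_empty momentum_path.lam_nonneg[OF path] momentum_path.lam_less_1[OF path] by auto

lemma q_adapted: "q k \<in> borel_measurable (F k)"
proof -
  have "(\<lambda>\<omega>. y k \<omega> + nu *\<^sub>R m k \<omega>) \<in> borel_measurable (F k)"
    using y_adapted m_adapted by measurable
  also have "?this \<longleftrightarrow> ?thesis"
    by (intro measurable_cong) (simp add: space_F momentum_path.q_eq[OF path])
  finally show ?thesis .
qed

lemma z_adapted: "z k \<in> borel_measurable (F k)"
proof -
  have "(\<lambda>\<omega>. y k \<omega> + (lam / (1 - lam)) *\<^sub>R m k \<omega>) \<in> borel_measurable (F k)"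
    using y_adapted m_adapted by measurable
  also have "?this \<longleftrightarrow> ?thesis"
    by (intro measurable_cong) (simp add: space_F momentum_path.z_eq[OF path])
  finally show ?thesis .
qed

lemma square_integrable_cong:
  assumes "square_integrable M X" "\<And>\<omega>. \<omega> \<in> space M \<Longrightarrow> X \<omega> = Y \<omega>"
  shows "square_integrable M Y"
  using assms measurable_cong[of M X Y borel]
    Bochner_Integration.integrable_cong[of M M "\<lambda>\<omega>. (norm (X \<omega>))\<^sup>2" "\<lambda>\<omega>. (norm (Y \<omega>))\<^sup>2"]
  by (auto simp: square_integrable_def)

lemma noise_L2: "square_integrable M (e k)"
  by (simp add: square_integrable_def noise_square_integrable)

lemma iterates_L2: "square_integrable M (y k) \<and> square_integrable M (m k)"
proof (induction k)
  case 0
  show ?case using y_0 m_0 by simp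
next
  case (Suc k)
  have q: "square_integrable M (q k)"
    by (rule square_integrable_cong[of "\<lambda>\<omega>. y k \<omega> + nu *\<^sub>R m k \<omega>"])
      (use Suc in \<open>auto intro: square_integrable_add square_integrable_scaleR
        simp: momentum_path.q_eq[OF path]\<close>)
  have m: "square_integrable M (m (Suc k))"
    by (rule square_integrable_cong[of "\<lambda>\<omega>. lam *\<^sub>R m k \<omega> - a k *\<^sub>R (gradient f (q k \<omega>) - e k \<omega>)"])
      (use Suc q noise_L2 in \<open>auto intro!: square_integrable_diff square_integrable_scaleR
        square_integrable_gradient finite_measure_axioms simp: momentum_path.m_Suc[OF path]\<close>)
  have "square_integrable M (y (Suc k))"
    by (rule square_integrable_cong[of "\<lambda>\<omega>. y k \<omega> + m (Suc k) \<omega>"])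
      (use Suc m in \<open>auto intro: square_integrable_add simp: momentum_path.y_Suc[OF path]\<close>)
  with m show ?case by simp
qed

lemma q_L2: "square_integrable M (q k)"
  by (rule square_integrable_cong[of "\<lambda>\<omega>. y k \<omega> + nu *\<^sub>R m k \<omega>"])
    (use iterates_L2[of k] in \<open>auto intro: square_integrable_add square_integrable_scaleR
      simp: momentum_path.q_eq[OF path]\<close>)

lemma z_L2: "square_integrable M (z k)"
  by (rule square_integrable_cong[of "\<lambda>\<omega>. y k \<omega> + (lam / (1 - lam)) *\<^sub>R m k \<omega>"])
    (use iterates_L2[of k] in \<open>auto intro: square_integrable_add square_integrable_scaleR
      simp: momentum_path.z_eq[OF path]\<close>)

lemma gradient_q_L2: "square_integrable M (\<lambda>\<omega>. gradient f (q k \<omega>))"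
  and gradient_z_L2: "square_integrable M (\<lambda>\<omega>. gradient f (z k \<omega>))"
  by (intro square_integrable_gradient finite_measure_axioms q_L2 z_L2)+

lemma gradient_z_adapted: "(\<lambda>\<omega>. gradient f (z k \<omega>)) \<in> borel_measurable (F k)"
  using z_adapted by measurable

text \<open>The guaranteed decrease of the energy in one step, noise aside.\<close>

definition dissipation :: "nat \<Rightarrow> 'a \<Rightarrow> real" where
  "dissipation k \<omega> = a k / (1 - lam) / 4 *
       ((norm (gradient f (z k \<omega>)))\<^sup>2 + (norm (gradient f (q k \<omega>)))\<^sup>2)
     + (1 - lam) / 2 * (norm (m k \<omega>))\<^sup>2"

definition mean_energy :: "nat \<Rightarrow> real" where
  "mean_energy k = (\<integral>\<omega>. f (z k \<omega>) + (norm (m k \<omega>))\<^sup>2 \<partial>M)"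

lemma dissipation_nonneg: "0 \<le> dissipation k \<omega>"
  using step_pos[of k] lam_less_1 by (simp add: dissipation_def)

lemma dissipation_integrable: "integrable M (dissipation k)"
  unfolding dissipation_def using gradient_q_L2[of k] gradient_z_L2[of k] iterates_L2[of k]
  by (auto simp: square_integrable_def)

lemma energy_integrable: "integrable M (\<lambda>\<omega>. f (z k \<omega>) + (norm (m k \<omega>))\<^sup>2)"
  using iterates_L2[of k] integrable_objective[OF finite_measure_axioms z_L2[of k]]
  by (auto simp: square_integrable_def)

text \<open>
  In expectation the first-order noise term of \<open>energy_decrease\<close> vanishes, as the gradient at
  \<open>z k\<close> is determined by the past, and the second-order one is bounded by the variance.
\<close>

lemma mean_energy_decrease:
  "\<exists>C. \<forall>\<^sub>F k in sequentially.
     mean_energy (Suc k) + (\<integral>\<omega>. dissipation k \<omega> \<partial>M) \<le> mean_energy k + C * (a k)\<^sup>2"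
proof
  define K where "K = 2 * L / (1 - lam)\<^sup>2 + 2 / (1 - lam)"
  have K: "K \<ge> 0"
    using L_pos lam_less_1 by (simp add: K_def)
  obtain \<omega>0 where \<omega>0: "\<omega>0 \<in> space M"
    using not_empty by blast
  show "\<forall>\<^sub>F k in sequentially.
     mean_energy (Suc k) + (\<integral>\<omega>. dissipation k \<omega> \<partial>M) \<le> mean_energy k + K * \<sigma>\<^sup>2 * (a k)\<^sup>2"
    using momentum_path.eventually_steps_small[OF path[OF \<omega>0]]
  proof eventually_elim
    case (elim k)
    define b where "b = a k / (1 - lam)"
    have cross: "integrable M (\<lambda>\<omega>. b * (gradient f (z k \<omega>) \<bullet> e k \<omega>))"
      "(\<integral>\<omega>. b * (gradient f (z k \<omega>) \<bullet> e k \<omega>) \<partial>M) = 0"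
      using noise_inner_integral_0[of "\<lambda>_. b" k, OF _ _ gradient_z_adapted] gradient_z_L2[of k]
      by (auto simp: square_integrable_def)
    have noise: "integrable M (\<lambda>\<omega>. K * ((a k)\<^sup>2 * (norm (e k \<omega>))\<^sup>2))"
      using noise_square_integrable by simp
    have "mean_energy (Suc k) + (\<integral>\<omega>. dissipation k \<omega> \<partial>M)
        = (\<integral>\<omega>. (f (z (Suc k) \<omega>) + (norm (m (Suc k) \<omega>))\<^sup>2) + dissipation k \<omega> \<partial>M)"
      unfolding mean_energy_def
      by (rule Bochner_Integration.integral_add[OF energy_integrable dissipation_integrable, symmetric])
    also have "\<dots> \<le> (\<integral>\<omega>. (f (z k \<omega>) + (norm (m k \<omega>))\<^sup>2) + b * (gradient f (z k \<omega>) \<bullet> e k \<omega>)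
        + K * ((a k)\<^sup>2 * (norm (e k \<omega>))\<^sup>2) \<partial>M)"
    proof (rule integral_mono)
      fix \<omega> assume "\<omega> \<in> space M"
      show "(f (z (Suc k) \<omega>) + (norm (m (Suc k) \<omega>))\<^sup>2) + dissipation k \<omega>
        \<le> (f (z k \<omega>) + (norm (m k \<omega>))\<^sup>2) + b * (gradient f (z k \<omega>) \<bullet> e k \<omega>)
          + K * ((a k)\<^sup>2 * (norm (e k \<omega>))\<^sup>2)"
        using momentum_path.energy_decrease[OF path[OF \<open>\<omega> \<in> space M\<close>], of k] elim
        unfolding dissipation_def b_def K_def by blast
    qed (intro Bochner_Integration.integrable_add energy_integrable dissipation_integrable cross noise)+
    also have "\<dots> = mean_energy k + K * ((a k)\<^sup>2 * (\<integral>\<omega>. (norm (e k \<omega>))\<^sup>2 \<partial>M))"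
      using energy_integrable cross noise
      by (subst Bochner_Integration.integral_add, simp, simp,
          subst Bochner_Integration.integral_add) (simp_all add: mean_energy_def)
    also have "\<dots> \<le> mean_energy k + K * ((a k)\<^sup>2 * \<sigma>\<^sup>2)"
      using K noise_square_integral by (intro add_left_mono mult_left_mono) auto
    finally show ?case
      by (simp add: mult_ac)
  qed
qed

text \<open>The mean energy is bounded below, so the total mean dissipation is finite.\<close>

lemma mean_dissipation_summable: "summable (\<lambda>k. \<integral>\<omega>. dissipation k \<omega> \<partial>M)"
proof -
  obtain C N where step: "\<And>k. k \<ge> N \<Longrightarrow>
      mean_energy (Suc k) + (\<integral>\<omega>. dissipation k \<omega> \<partial>M) \<le> mean_energy k + C * (a k)\<^sup>2"
    using mean_energy_decrease unfolding eventually_sequentially by blast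
  obtain B where B: "\<And>u. B \<le> f u"
    using bounded_below by (auto simp: bdd_below_def)
  have energy_ge: "B \<le> mean_energy k" for k
  proof -
    have "(\<integral>\<omega>. B \<partial>M) \<le> mean_energy k"
      unfolding mean_energy_def
      by (rule integral_mono[OF _ energy_integrable]) (auto intro: add_increasing2 B)
    then show ?thesis
      by (simp add: prob_space)
  qed
  have sum_le: "(\<Sum>k<n. \<integral>\<omega>. dissipation (k + N) \<omega> \<partial>M)
      \<le> mean_energy N - mean_energy (n + N) + (\<Sum>k<n. \<bar>C\<bar> * (a (k + N))\<^sup>2)" for n
  proof (induction n)
    case (Suc n)
    have "C * (a (n + N))\<^sup>2 \<le> \<bar>C\<bar> * (a (n + N))\<^sup>2"
      by (intro mult_right_mono) auto
    with Suc step[of "n + N"] show ?case by simp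
  qed simp
  have sq: "summable (\<lambda>k. \<bar>C\<bar> * (a (k + N))\<^sup>2)"
    using step_square_summable summable_iff_shift[of "\<lambda>k. (a k)\<^sup>2" N] by (simp add: summable_mult)
  have "summable (\<lambda>k. \<integral>\<omega>. dissipation (k + N) \<omega> \<partial>M)"
  proof (rule summableI_nonneg_bounded)
    show "(\<Sum>k<n. \<integral>\<omega>. dissipation (k + N) \<omega> \<partial>M)
        \<le> mean_energy N - B + (\<Sum>k. \<bar>C\<bar> * (a (k + N))\<^sup>2)" for n
      using sum_le[of n] energy_ge[of "n + N"] sum_le_suminf[OF sq, of "{..<n}"] by simp
  qed (simp add: dissipation_nonneg)
  then show ?thesis
    by (simp only: summable_iff_shift[of "\<lambda>k. \<integral>\<omega>. dissipation k \<omega> \<partial>M"])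
qed

lemma gradient_z_le_dissipation:
  "a k * (norm (gradient f (z k \<omega>)))\<^sup>2 \<le> 4 * (1 - lam) * dissipation k \<omega>"
  and gradient_q_le_dissipation:
  "a k * (norm (gradient f (q k \<omega>)))\<^sup>2 \<le> 4 * (1 - lam) * dissipation k \<omega>"
  and momentum_le_dissipation: "(norm (m k \<omega>))\<^sup>2 \<le> 2 / (1 - lam) * dissipation k \<omega>"
proof -
  define G H P where "G = a k * (norm (gradient f (z k \<omega>)))\<^sup>2"
    and "H = a k * (norm (gradient f (q k \<omega>)))\<^sup>2" and "P = (norm (m k \<omega>))\<^sup>2"
  have nonneg: "0 \<le> G" "0 \<le> H" "0 \<le> P"
    using step_pos[of k] by (auto simp: G_def H_def P_def)
  have 1: "1 - lam > 0"
    using lam_less_1 by simp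
  have D: "dissipation k \<omega> = (G + H) / (4 * (1 - lam)) + (1 - lam) / 2 * P"
    unfolding dissipation_def G_def H_def P_def distrib_left[symmetric] by simp
  have "4 * (1 - lam) * dissipation k \<omega> = (G + H) + 2 * (1 - lam)\<^sup>2 * P"
    unfolding D using 1 by (simp add: field_simps power2_eq_square)
  moreover have "0 \<le> 2 * (1 - lam)\<^sup>2 * P"
    using nonneg by simp
  ultimately show "G \<le> 4 * (1 - lam) * dissipation k \<omega>" "H \<le> 4 * (1 - lam) * dissipation k \<omega>"
    using nonneg by linarith+
  have scale: "2 / c * ((G + H) / (4 * c) + c / 2 * P) = (G + H) / (2 * c\<^sup>2) + P" if "c > 0" for c
    using that by (simp add: distrib_left power2_eq_square divide_simps)
  have "2 / (1 - lam) * dissipation k \<omega> = (G + H) / (2 * (1 - lam)\<^sup>2) + P"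
    unfolding D by (rule scale[OF 1])
  moreover have "0 \<le> (G + H) / (2 * (1 - lam)\<^sup>2)"
    using nonneg by simp
  ultimately show "P \<le> 2 / (1 - lam) * dissipation k \<omega>"
    by linarith
qed

text \<open>Convergence of the vector-valued series is convergence of its finitely many coordinates.\<close>

lemma AE_noise_summable: "AE \<omega> in M. summable (\<lambda>k. a k *\<^sub>R e k \<omega>)"
proof -
  have "AE \<omega> in M. \<forall>b\<in>Basis. summable (\<lambda>k. (a k *\<^sub>R b) \<bullet> e k \<omega>)"
  proof (rule AE_finite_allI)
    fix b :: "real ^ 'd" assume "b \<in> Basis"
    then show "AE \<omega> in M. summable (\<lambda>k. (a k *\<^sub>R b) \<bullet> e k \<omega>)"
      using AE_noise_series_summable[of "\<lambda>k _. a k *\<^sub>R b"] step_square_summable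
      by (simp add: predictable_L2_def prob_space)
  qed simp
  then show ?thesis
  proof eventually_elim
    case (elim \<omega>)
    have "a k *\<^sub>R e k \<omega> = (\<Sum>b\<in>Basis. ((a k *\<^sub>R b) \<bullet> e k \<omega>) *\<^sub>R b)" for k
      using euclidean_representation[of "a k *\<^sub>R e k \<omega>"] by (simp add: inner_commute)
    then show ?case
      using elim by (simp only:) (intro summable_sum summable_scaleR_left, blast)
  qed
qed

lemma AE_noise_square_summable: "AE \<omega> in M. summable (\<lambda>k. (a k)\<^sup>2 * (norm (e k \<omega>))\<^sup>2)"
proof (rule AE_summable_of_expectations)
  show "summable (\<lambda>k. \<integral>\<omega>. (a k)\<^sup>2 * (norm (e k \<omega>))\<^sup>2 \<partial>M)"
  proof (rule summable_comparison_test')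
    show "summable (\<lambda>k. (a k)\<^sup>2 * \<sigma>\<^sup>2)"
      using step_square_summable by (rule summable_mult2)
    show "norm (\<integral>\<omega>. (a k)\<^sup>2 * (norm (e k \<omega>))\<^sup>2 \<partial>M) \<le> (a k)\<^sup>2 * \<sigma>\<^sup>2" for k
      using noise_square_integral[of k] by (simp add: mult_left_mono abs_mult)
  qed
qed (use noise_square_integrable in auto)

text \<open>
  The second moments of the weights carry a factor \<open>(a k)\<^sup>2\<close>; one power is bounded by
  \<open>a 0\<close>, and the other one turns the squared gradient into a part of the dissipation.
\<close>

lemma AE_noise_gradient_summable: "AE \<omega> in M. summable (\<lambda>k. a k * (gradient f (z k \<omega>) \<bullet> e k \<omega>))"
proof -
  define Y where "Y k \<omega> = a k *\<^sub>R gradient f (z k \<omega>)" for k \<omega>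
  have Y_int: "integrable M (\<lambda>\<omega>. (norm (Y k \<omega>))\<^sup>2)" for k
    using square_integrable_scaleR[OF gradient_z_L2] by (auto simp: square_integrable_def Y_def)
  have "predictable_L2 Y"
    unfolding predictable_L2_def using Y_int gradient_z_adapted
    by (auto simp: Y_def[abs_def] intro: borel_measurable_scaleR)
  moreover have "summable (\<lambda>k. \<integral>\<omega>. (norm (Y k \<omega>))\<^sup>2 \<partial>M)"
  proof (rule summable_comparison_test')
    define c where "c = a 0 * (4 * (1 - lam))"
    show "summable (\<lambda>k. c * (\<integral>\<omega>. dissipation k \<omega> \<partial>M))"
      by (intro summable_mult mean_dissipation_summable)
    fix k
    have "(norm (Y k \<omega>))\<^sup>2 \<le> c * dissipation k \<omega>" for \<omega>
    proof -
      have "(norm (Y k \<omega>))\<^sup>2 = a k * (a k * (norm (gradient f (z k \<omega>)))\<^sup>2)"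
        by (simp add: Y_def power_mult_distrib power2_eq_square)
      also have "\<dots> \<le> a 0 * (4 * (1 - lam) * dissipation k \<omega>)"
        using step_pos[of k] step_pos[of 0]
        by (intro mult_mono step_le_first gradient_z_le_dissipation) auto
      finally show ?thesis
        by (simp add: c_def mult.assoc)
    qed
    then have "(\<integral>\<omega>. (norm (Y k \<omega>))\<^sup>2 \<partial>M) \<le> (\<integral>\<omega>. c * dissipation k \<omega> \<partial>M)"
      by (intro integral_mono Y_int) (simp_all add: dissipation_integrable)
    then show "norm (\<integral>\<omega>. (norm (Y k \<omega>))\<^sup>2 \<partial>M) \<le> c * (\<integral>\<omega>. dissipation k \<omega> \<partial>M)"
      by simp
  qed
  ultimately have "AE \<omega> in M. summable (\<lambda>k. Y k \<omega> \<bullet> e k \<omega>)"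
    by (rule AE_noise_series_summable)
  then show ?thesis
    by (simp add: Y_def)
qed

theorem AE_tame:
  "AE \<omega> in M. tame_momentum_path f L a lam nu
     (\<lambda>k. y k \<omega>) (\<lambda>k. m k \<omega>) (\<lambda>k. q k \<omega>) (\<lambda>k. z k \<omega>) (\<lambda>k. e k \<omega>)"
proof -
  have "AE \<omega> in M. summable (\<lambda>k. dissipation k \<omega>)"
    by (rule AE_summable_of_expectations[OF dissipation_integrable dissipation_nonneg
          mean_dissipation_summable])
  then show ?thesis
    using AE_noise_summable AE_noise_square_summable AE_noise_gradient_summable AE_space
  proof eventually_elim
    case (elim \<omega>)
    have "summable (\<lambda>k. a k * (norm (gradient f (z k \<omega>)))\<^sup>2)"
      by (rule summable_comparison_test'[OF summable_mult[OF elim(1), of "4 * (1 - lam)"]])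
        (use gradient_z_le_dissipation step_pos in \<open>simp add: less_imp_le abs_mult\<close>)
    moreover have "summable (\<lambda>k. a k * (norm (gradient f (q k \<omega>)))\<^sup>2)"
      by (rule summable_comparison_test'[OF summable_mult[OF elim(1), of "4 * (1 - lam)"]])
        (use gradient_q_le_dissipation step_pos in \<open>simp add: less_imp_le abs_mult\<close>)
    moreover have "summable (\<lambda>k. (norm (m k \<omega>))\<^sup>2)"
      by (rule summable_comparison_test'[OF summable_mult[OF elim(1), of "2 / (1 - lam)"]])
        (use momentum_le_dissipation in simp)
    ultimately show ?case
      using elim path unfolding tame_momentum_path_def tame_momentum_path_axioms_def by blast
  qed
qed

end

section \<open>Time windows\<close>

lemma time_index_ge: "k \<le> time_index \<alpha> T k"
proof (induction k rule: induct_nat_012)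
  case (ge2 k)
  then show ?case
    by (auto simp: next_index_def)
qed simp_all

text \<open>
  A time block either stays within clock length \<open>T\<close> or consists of a single step, which is at most
  \<open>a 0\<close>. The indices are shifted by one, since \<open>a\<close> starts with the step size at time \<open>1\<close>.
\<close>

lemma (in step_sizes) time_block_clock:
  assumes a: "a = (\<lambda>k. \<alpha> (Suc k))" and T: "T \<ge> 0" and k: "k \<ge> 1"
    and l: "l \<in> time_block \<alpha> T k"
  shows "(\<Sum>i=time_index \<alpha> T k - 1..<l - 1. a i) \<le> T + a 0"
proof -
  define s where "s = time_index \<alpha> T k - 1"
  define t where "t = l - 1"
  have s: "time_index \<alpha> T k = Suc s"
    using time_index_ge[of k \<alpha> T] k by (simp add: s_def)
  have t: "l = Suc t" "s < t"
    using l s by (auto simp: time_block_def t_def)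
  have clock: "step_sum \<alpha> (Suc i) (Suc j) = (\<Sum>k=i..<j. a k)" for i j
    by (simp only: step_sum_def a sum.shift_bounds_Suc_ivl)
  define S where "S = {n. n \<ge> Suc s \<and> step_sum \<alpha> (Suc s) n \<le> T}"
  have "k = Suc (k - 1)"
    using k by simp
  then have "time_index \<alpha> T (k + 1) = next_index \<alpha> T (Suc s)"
    using s by (metis Suc_eq_plus1 time_index.simps(3))
  then have "l \<le> max (Suc s + 1) (Sup S)"
    using l by (simp add: time_block_def next_index_def S_def)
  then consider "l = Suc (Suc s)" | "l \<le> Sup S"
    using t by (auto simp: max_def split: if_splits)
  then have "(\<Sum>i=s..<t. a i) \<le> T + a 0"
  proof cases
    case 1
    then show ?thesis
      using t(1) T step_le_first[of s] by simp
  next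
    case 2
    \<comment> \<open>the clock diverges, so the supremum is attained\<close>
    have fin: "finite S"
    proof -
      obtain r where r: "r \<ge> s" "T < (\<Sum>i=s..<r. a i)"
        using step_sum_unbounded[of s T] by blast
      have "n \<le> Suc r" if "n \<in> S" for n
      proof (rule ccontr)
        assume "\<not> n \<le> Suc r"
        then obtain n' where n': "n = Suc n'" "r \<le> n'"
          by (cases n) auto
        have "(\<Sum>i=s..<r. a i) \<le> (\<Sum>i=s..<n'. a i)"
          using n' step_pos by (intro sum_mono2) (auto simp: less_imp_le)
        then show False
          using that r n' by (simp add: S_def clock)
      qed
      then show ?thesis
        using finite_subset[of S "{..Suc r}"] by auto
    qed
    have ne: "Suc s \<in> S"
      using T by (simp add: S_def step_sum_def)
    have "Sup S = Max S"
      using fin ne by (intro cSup_eq_Max) auto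
    moreover have "Max S \<in> S"
      using fin ne by (intro Max_in) auto
    ultimately have "Sup S \<in> S"
      by simp
    then obtain r where r: "Sup S = Suc r" "(\<Sum>i=s..<r. a i) \<le> T"
      by (cases "Sup S") (auto simp: S_def clock)
    have "(\<Sum>i=s..<t. a i) \<le> (\<Sum>i=s..<r. a i)"
      using 2 r t step_pos by (intro sum_mono2) (auto simp: less_imp_le)
    then show ?thesis
      using r step_pos[of 0] by simp
  qed
  then show ?thesis
    by (simp add: s_def t_def)
qed

lemma iterate_dist_tendsto_0:
  fixes x :: "nat \<Rightarrow> 'a \<Rightarrow> real ^ 'd"
  assumes path: "tame_momentum_path f L a lam nu (\<lambda>k. x (Suc k) \<omega>) m q
      (\<lambda>k. aux_seq lam x (Suc k) \<omega>) e"
    and a: "a = (\<lambda>k. \<alpha> (Suc k))" and T: "T \<ge> 0"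
  shows "(\<lambda>k. iterate_dist \<alpha> T lam x k \<omega>) \<longlonglongrightarrow> 0"
proof -
  interpret P: tame_momentum_path f L a lam nu "\<lambda>k. x (Suc k) \<omega>" m q "\<lambda>k. aux_seq lam x (Suc k) \<omega>" e
    by (rule path)
  have block: "finite (time_block \<alpha> T k)" "time_index \<alpha> T (k + 1) \<in> time_block \<alpha> T k" if "k \<ge> 1" for k
  proof -
    have "time_block \<alpha> T k = {time_index \<alpha> T k<..time_index \<alpha> T (k + 1)}"
      by (auto simp: time_block_def)
    then show "finite (time_block \<alpha> T k)"
      by simp
    from that obtain j where "k = Suc j"
      by (cases k) auto
    then show "time_index \<alpha> T (k + 1) \<in> time_block \<alpha> T k"
      by (simp add: time_block_def next_index_def)
  qed
  have small: "\<forall>\<^sub>F k in sequentially.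
      (MAX l\<in>time_block \<alpha> T k. norm (u l - u (time_index \<alpha> T k))) < \<epsilon>"
    if "\<epsilon> > 0" and window: "\<forall>\<^sub>F s in sequentially. \<forall>t\<ge>s. (\<Sum>k=s..<t. a k) \<le> T + a 0 \<longrightarrow>
        norm (u (Suc t) - u (Suc s)) < \<epsilon>" for u :: "nat \<Rightarrow> real ^ 'd" and \<epsilon>
  proof -
    obtain N where N: "\<And>s t. s \<ge> N \<Longrightarrow> t \<ge> s \<Longrightarrow> (\<Sum>k=s..<t. a k) \<le> T + a 0 \<Longrightarrow>
        norm (u (Suc t) - u (Suc s)) < \<epsilon>"
      using window unfolding eventually_sequentially by blast
    show ?thesis
      using eventually_ge_at_top[of "Suc N"]
    proof eventually_elim
      case (elim k)
      then have k: "k \<ge> 1"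
        by simp
      have "norm (u l - u (time_index \<alpha> T k)) < \<epsilon>" if l: "l \<in> time_block \<alpha> T k" for l
      proof -
        have "time_index \<alpha> T k < l"
          using l by (simp add: time_block_def)
        with N[OF _ _ P.time_block_clock[OF a T k l]] time_index_ge[of k \<alpha> T] elim
        show ?thesis by simp
      qed
      then show ?case
        using block[OF k] by (subst Max_less_iff) auto
    qed
  qed
  show ?thesis
  proof (rule order_tendstoI)
    fix \<epsilon> :: real assume "\<epsilon> < 0"
    show "\<forall>\<^sub>F k in sequentially. \<epsilon> < iterate_dist \<alpha> T lam x k \<omega>"
      using eventually_ge_at_top[of 1]
    proof eventually_elim
      case (elim k)
      have "0 \<le> norm (x (time_index \<alpha> T (k + 1)) \<omega> - x (time_index \<alpha> T k) \<omega>)"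
        by simp
      also have "\<dots> \<le> (MAX l\<in>time_block \<alpha> T k. norm (x l \<omega> - x (time_index \<alpha> T k) \<omega>))"
        using block[OF elim] by (intro Max_ge) auto
      also have "\<dots> \<le> iterate_dist \<alpha> T lam x k \<omega>"
        by (simp add: iterate_dist_def)
      finally show ?case
        using \<open>\<epsilon> < 0\<close> by simp
    qed
  next
    fix \<epsilon> :: real assume "0 < \<epsilon>"
    show "\<forall>\<^sub>F k in sequentially. iterate_dist \<alpha> T lam x k \<omega> < \<epsilon>"
      using small[OF \<open>0 < \<epsilon>\<close>, of "\<lambda>k. x k \<omega>", OF P.y_window_small[OF \<open>0 < \<epsilon>\<close>]]
        small[OF \<open>0 < \<epsilon>\<close>, of "\<lambda>k. aux_seq lam x k \<omega>", OF P.z_window_small[OF \<open>0 < \<epsilon>\<close>]]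
      by eventually_elim (simp add: iterate_dist_def)
  qed
qed

section \<open>The natural filtration of the momentum method\<close>

lemma natural_filtration_measurable:
  fixes x :: "nat \<Rightarrow> 'a \<Rightarrow> real ^ 'd"
  assumes "i \<le> k"
  shows "x i \<in> borel_measurable (natural_filtration M x k)"
proof (rule measurableI)
  fix B :: "(real ^ 'd) set" assume "B \<in> sets borel"
  then show "x i -` B \<inter> space (natural_filtration M x k) \<in> sets (natural_filtration M x k)"
    using assms unfolding natural_filtration_def
    by (subst sets_measure_of, blast, subst space_measure_of, blast) (blast intro: sigma_sets.Basic)
qed simp

lemma space_natural_filtration: "space (natural_filtration M x k) = space M"
  unfolding natural_filtration_def by (rule space_measure_of) blast

lemma natural_filtration_mono:
  "sets (natural_filtration M x k) \<subseteq> sets (natural_filtration M x (Suc k))"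
  unfolding natural_filtration_def
  by (subst (1 2) sets_measure_of) (blast, blast, rule sigma_sets_mono', blast intro: le_SucI)

lemma natural_filtration_subalgebra:
  assumes "\<And>i. i \<le> k \<Longrightarrow> x i \<in> borel_measurable M"
  shows "subalgebra M (natural_filtration M x k)"
  unfolding subalgebra_def
proof
  show "sets (natural_filtration M x k) \<subseteq> sets M"
    unfolding natural_filtration_def
    by (subst sets_measure_of, blast, rule sets.sigma_sets_subset)
      (use assms in \<open>auto intro: measurable_sets\<close>)
qed (rule space_natural_filtration)

text \<open>
  The method in the form of the abstract recursion. Time is shifted by one, so that the recursion
  starts at \<open>y 0 = x 1\<close>; the displacement into this point is \<open>0\<close> because \<open>x 0\<close> and
  \<open>x 1\<close> agree.
\<close>

lemma sgdm_stochastic_momentum: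
  fixes M :: "'a measure" and f :: "real ^ 'd \<Rightarrow> real" and e x :: "nat \<Rightarrow> 'a \<Rightarrow> real ^ 'd"
  assumes M: "prob_space M" and f: "smooth_objective f L" and bdd: "bdd_below (range f)"
    and steps: "step_sizes (\<lambda>k. \<alpha> (Suc k))" and lam: "0 \<le> lam" "lam < 1"
    and e: "\<And>k. k \<ge> 1 \<Longrightarrow> e k \<in> borel_measurable M"
    and sgdm: "sgdm M f \<alpha> lam \<nu> x0 e x"
    and centered: "\<And>k. k \<ge> 1 \<Longrightarrow>
      AE \<omega> in M. vec_cond_exp M (natural_filtration M x k) (e k) \<omega> = 0"
    and variance: "\<And>k. k \<ge> 1 \<Longrightarrow> AE \<omega> in M.
           nn_cond_exp M (natural_filtration M x k) (\<lambda>\<omega>'. ennreal ((norm (e k \<omega>'))\<^sup>2)) \<omega>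
             \<le> ennreal (\<sigma>\<^sup>2)"
  defines "y \<equiv> \<lambda>k. x (Suc k)" and "m \<equiv> \<lambda>k \<omega>. x (Suc k) \<omega> - x k \<omega>"
    and "q \<equiv> \<lambda>k \<omega>. x (Suc k) \<omega> + \<nu> *\<^sub>R (x (Suc k) \<omega> - x k \<omega>)"
  shows "stochastic_momentum f L (\<lambda>k. \<alpha> (Suc k)) M (\<lambda>k. natural_filtration M x (Suc k))
      (\<lambda>k. e (Suc k)) \<sigma> lam \<nu> y m q (\<lambda>k. aux_seq lam x (Suc k))
    \<and> (\<forall>k. x k \<in> borel_measurable M)" (is "?momentum \<and> _")
proof (rule conjI)
  interpret prob_space M by (rule M)
  interpret f: smooth_objective f L by (rule f)
  interpret a: step_sizes "\<lambda>k. \<alpha> (Suc k)" by (rule steps)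
  have init: "x 0 \<omega> = x0" "x (Suc 0) \<omega> = x0" if "\<omega> \<in> space M" for \<omega>
    using sgdm that by (auto simp: sgdm_def)
  have step: "x (Suc (Suc k)) \<omega> = x (Suc k) \<omega>
      - \<alpha> (Suc k) *\<^sub>R (gradient f (q k \<omega>) - e (Suc k) \<omega>) + lam *\<^sub>R m k \<omega>"
    if "\<omega> \<in> space M" for k \<omega>
  proof -
    have "\<forall>k\<ge>1. let xt = x k \<omega> + \<nu> *\<^sub>R (x k \<omega> - x (k - 1) \<omega>);
             g = gradient f xt - e k \<omega>
         in x (k + 1) \<omega> = x k \<omega> - \<alpha> k *\<^sub>R g + lam *\<^sub>R (x k \<omega> - x (k - 1) \<omega>)"
      using sgdm that by (auto simp: sgdm_def)
    from this[rule_format, of "Suc k"] show ?thesis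
      by (simp add: q_def m_def Let_def)
  qed
  have meas: "x k \<in> borel_measurable M \<and> x (Suc k) \<in> borel_measurable M" for k
  proof (induction k)
    case 0
    have "x 0 \<in> borel_measurable M \<longleftrightarrow> (\<lambda>_. x0) \<in> borel_measurable M"
      "x (Suc 0) \<in> borel_measurable M \<longleftrightarrow> (\<lambda>_. x0) \<in> borel_measurable M"
      by (intro measurable_cong; simp add: init)+
    then show ?case by simp
  next
    case (Suc k)
    then have [measurable]: "x k \<in> borel_measurable M" "x (Suc k) \<in> borel_measurable M"
      "e (Suc k) \<in> borel_measurable M"
      using e by auto
    have "(\<lambda>\<omega>. x (Suc k) \<omega> - \<alpha> (Suc k) *\<^sub>R (gradient f (q k \<omega>) - e (Suc k) \<omega>) + lam *\<^sub>R m k \<omega>)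
        \<in> borel_measurable M"
      unfolding q_def m_def by measurable
    also have "?this \<longleftrightarrow> x (Suc (Suc k)) \<in> borel_measurable M"
      by (intro measurable_cong) (simp add: step)
    finally show ?case
      using Suc by simp
  qed
  then have x_meas: "x k \<in> borel_measurable M" for k
    by blast
  then show "\<forall>k. x k \<in> borel_measurable M"
    by blast
  have adapted: "x i \<in> borel_measurable (natural_filtration M x k)" if "i \<le> k" for i k
    using that by (rule natural_filtration_measurable)
  have q_adapted: "q k \<in> borel_measurable (natural_filtration M x (Suc k))"
    and m_adapted: "m k \<in> borel_measurable (natural_filtration M x (Suc k))" for k
    unfolding q_def m_def using adapted[of k "Suc k"] adapted[of "Suc k" "Suc k"] by auto
  \<comment> \<open>the error is recovered from the three consecutive iterates around it\<close>
  have e_adapted: "e (Suc k) \<in> borel_measurable (natural_filtration M x (Suc (Suc k)))" for k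
  proof -
    define F where "F = natural_filtration M x (Suc (Suc k))"
    have [measurable]: "x k \<in> borel_measurable F" "x (Suc k) \<in> borel_measurable F"
      "x (Suc (Suc k)) \<in> borel_measurable F"
      unfolding F_def by (auto intro: adapted)
    have "(\<lambda>\<omega>. gradient f (q k \<omega>) + (1 / \<alpha> (Suc k)) *\<^sub>R
        (x (Suc (Suc k)) \<omega> - x (Suc k) \<omega> - lam *\<^sub>R m k \<omega>)) \<in> borel_measurable F"
      unfolding q_def m_def by measurable
    also have "?this \<longleftrightarrow> e (Suc k) \<in> borel_measurable F"
      using a.step_pos[of k]
      by (intro measurable_cong) (simp add: F_def space_natural_filtration step)
    finally show ?thesis
      by (simp add: F_def)
  qed
  interpret N: martingale_noise M "\<lambda>k. natural_filtration M x (Suc k)" "\<lambda>k. e (Suc k)" \<sigma>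
  proof unfold_locales
    fix k
    show "subalgebra M (natural_filtration M x (Suc k))"
      by (rule natural_filtration_subalgebra) (rule x_meas)
    show "sets (natural_filtration M x (Suc k)) \<subseteq> sets (natural_filtration M x (Suc (Suc k)))"
      by (rule natural_filtration_mono)
    show "e (Suc k) \<in> borel_measurable (natural_filtration M x (Suc (Suc k)))"
      by (rule e_adapted)
  qed (rule centered variance, simp)+
  show ?momentum
  proof (intro stochastic_momentum.intro stochastic_momentum_axioms.intro)
    show "momentum_path f L (\<lambda>k. \<alpha> (Suc k)) lam \<nu> (\<lambda>k. y k \<omega>) (\<lambda>k. m k \<omega>) (\<lambda>k. q k \<omega>)
        (\<lambda>k. aux_seq lam x (Suc k) \<omega>) (\<lambda>k. e (Suc k) \<omega>)" if \<omega>: "\<omega> \<in> space M" for \<omega>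
    proof unfold_locales
      fix k
      show "m (Suc k) \<omega> = lam *\<^sub>R m k \<omega> - \<alpha> (Suc k) *\<^sub>R (gradient f (q k \<omega>) - e (Suc k) \<omega>)"
        using step[OF \<omega>, of k] by (simp add: m_def)
      have "1 / (1 - lam) = 1 + lam / (1 - lam)"
        using lam by (simp add: field_simps)
      then show "aux_seq lam x (Suc k) \<omega> = y k \<omega> + (lam / (1 - lam)) *\<^sub>R m k \<omega>"
        by (simp add: aux_seq_def y_def m_def scaleR_add_left scaleR_diff_right)
    qed (use lam in \<open>simp_all add: y_def m_def q_def\<close>)
    show "y k \<in> borel_measurable (natural_filtration M x (Suc k))" for k
      unfolding y_def by (rule adapted) simp
    have "integrable M (\<lambda>\<omega>. (norm (y 0 \<omega>))\<^sup>2) \<longleftrightarrow> integrable M (\<lambda>\<omega>. (norm x0)\<^sup>2)"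
      by (intro Bochner_Integration.integrable_cong) (simp_all add: y_def init)
    then show "square_integrable M (y 0)"
      using x_meas by (simp add: square_integrable_def y_def)
    have "integrable M (\<lambda>\<omega>. (norm (m 0 \<omega>))\<^sup>2) \<longleftrightarrow> integrable M (\<lambda>\<omega>. 0 :: real)"
      by (intro Bochner_Integration.integrable_cong) (simp_all add: m_def init)
    then show "square_integrable M (m 0)"
      using x_meas by (simp add: square_integrable_def m_def)
  qed (rule f steps N.martingale_noise_axioms bdd m_adapted)+
qed

section \<open>Convergence of the momentum method\<close>

lemma step_sizes_Suc:
  assumes pos: "\<And>k. k \<ge> 1 \<Longrightarrow> \<alpha> k > 0" and mono: "antimono_on {1..} \<alpha>"
    and diverges: "filterlim (\<lambda>n. \<Sum>k=1..n. \<alpha> k) at_top sequentially"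
    and square: "summable (\<lambda>k. (\<alpha> (k + 1))\<^sup>2)"
  shows "step_sizes (\<lambda>k. \<alpha> (Suc k))"
proof
  show "decseq (\<lambda>k. \<alpha> (Suc k))"
    using mono by (auto simp: decseq_def monotone_on_def)
  show "\<not> summable (\<lambda>k. \<alpha> (Suc k))"
  proof
    assume "summable (\<lambda>k. \<alpha> (Suc k))"
    then have "(\<lambda>n. \<Sum>k=1..n. \<alpha> k) \<longlonglongrightarrow> (\<Sum>k. \<alpha> (Suc k))"
      using summable_LIMSEQ by (simp add: sum.atLeast1_atMost_eq)
    then show False
      using not_tendsto_and_filterlim_at_infinity[OF sequentially_bot _
          filterlim_at_top_imp_at_infinity[OF diverges]] by blast
  qed
qed (use pos square in auto)

theorem theorem4p1:
  fixes M :: "'a measure"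
    and f :: "real ^ 'd \<Rightarrow> real"
    and L lam \<nu> \<sigma> T :: real
    and \<alpha> :: "nat \<Rightarrow> real"
    and x0 :: "real ^ 'd"
    and e x z :: "nat \<Rightarrow> 'a \<Rightarrow> real ^ 'd"
    and d :: "nat \<Rightarrow> 'a \<Rightarrow> real"
  assumes "prob_space M"
    and "f differentiable_on UNIV"
    and "bdd_below (range f)"
    and "L > 0"
    and "L-lipschitz_on UNIV (gradient f)"
    and "0 \<le> lam" and "lam < 1"
    and "\<nu> \<ge> 0"
    and "\<And>k. k \<ge> 1 \<Longrightarrow> e k \<in> borel_measurable M"
    and "sgdm M f \<alpha> lam \<nu> x0 e x"
    and "\<sigma> \<ge> 0"
    and "\<And>k. k \<ge> 1 \<Longrightarrow> AE \<omega> in M. vec_cond_exp M (natural_filtration M x k) (e k) \<omega> = 0"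
    and "\<And>k. k \<ge> 1 \<Longrightarrow> AE \<omega> in M.
           nn_cond_exp M (natural_filtration M x k) (\<lambda>\<omega>'. ennreal ((norm (e k \<omega>'))\<^sup>2)) \<omega>
             \<le> ennreal (\<sigma>\<^sup>2)"
    and "\<And>k. k \<ge> 1 \<Longrightarrow> \<alpha> k > 0"
    and "antimono_on {1..} \<alpha>"
    and "filterlim (\<lambda>n. \<Sum>k=1..n. \<alpha> k) at_top sequentially"
    and "summable (\<lambda>k. (\<alpha> (k + 1))\<^sup>2)"
    and T_def: "T = (1 - lam) ^ 3 / (50 * L * (1 + 2 * \<nu>)\<^sup>2)"
    and z_def: "z = aux_seq lam x"
    and d_def: "d = iterate_dist \<alpha> T lam x"
  shows "(AE \<omega> in M.
            (\<lambda>k. d k \<omega>) \<longlonglongrightarrow> 0 \<and>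
            (\<lambda>k. norm (x k \<omega> - z k \<omega>)) \<longlonglongrightarrow> 0 \<and>
            (\<lambda>k. norm (gradient f (x k \<omega>))) \<longlonglongrightarrow> 0 \<and>
            (\<lambda>k. norm (gradient f (z k \<omega>))) \<longlonglongrightarrow> 0) \<and>
         (\<exists>fstar. fstar \<in> borel_measurable M \<and>
            (AE \<omega> in M. (\<lambda>k. f (x k \<omega>)) \<longlonglongrightarrow> fstar \<omega> \<and> (\<lambda>k. f (z k \<omega>)) \<longlonglongrightarrow> fstar \<omega>))"
proof -
  have f: "smooth_objective f L"
    using assms(2,4,5) by (simp add: smooth_objective_def)
  have steps: "step_sizes (\<lambda>k. \<alpha> (Suc k))"
    using assms(14-17) by (rule step_sizes_Suc)
  have momentum: "stochastic_momentum f L (\<lambda>k. \<alpha> (Suc k)) M (\<lambda>k. natural_filtration M x (Suc k))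
      (\<lambda>k. e (Suc k)) \<sigma> lam \<nu> (\<lambda>k. x (Suc k)) (\<lambda>k \<omega>. x (Suc k) \<omega> - x k \<omega>)
      (\<lambda>k \<omega>. x (Suc k) \<omega> + \<nu> *\<^sub>R (x (Suc k) \<omega> - x k \<omega>)) (\<lambda>k. aux_seq lam x (Suc k))
    \<and> (\<forall>k. x k \<in> borel_measurable M)"
    by (rule sgdm_stochastic_momentum[where ?x0.0 = x0]) (fact f steps assms)+
  have T: "T \<ge> 0"
    using assms(4,7) by (simp add: T_def)
  have limits: "AE \<omega> in M. (\<lambda>k. d k \<omega>) \<longlonglongrightarrow> 0 \<and>
      (\<lambda>k. norm (x k \<omega> - z k \<omega>)) \<longlonglongrightarrow> 0 \<and>
      (\<lambda>k. norm (gradient f (x k \<omega>))) \<longlonglongrightarrow> 0 \<and>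
      (\<lambda>k. norm (gradient f (z k \<omega>))) \<longlonglongrightarrow> 0 \<and>
      convergent (\<lambda>k. f (z k \<omega>)) \<and> (\<lambda>k. f (x k \<omega>) - f (z k \<omega>)) \<longlonglongrightarrow> 0"
    using stochastic_momentum.AE_tame[OF conjunct1[OF momentum]]
  proof eventually_elim
    case (elim \<omega>)
    interpret P: tame_momentum_path f L "\<lambda>k. \<alpha> (Suc k)" lam \<nu> "\<lambda>k. x (Suc k) \<omega>"
      "\<lambda>k. x (Suc k) \<omega> - x k \<omega>" "\<lambda>k. x (Suc k) \<omega> + \<nu> *\<^sub>R (x (Suc k) \<omega> - x k \<omega>)"
      "\<lambda>k. aux_seq lam x (Suc k) \<omega>" "\<lambda>k. e (Suc k) \<omega>"
      by (rule elim)
    have "convergent (\<lambda>k. f (z k \<omega>))"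
      using P.objective_z_convergent convergent_Suc_iff[of "\<lambda>k. f (z k \<omega>)"] by (simp add: z_def)
    moreover have "(\<lambda>k. d k \<omega>) \<longlonglongrightarrow> 0"
      unfolding d_def using elim T by (rule iterate_dist_tendsto_0[OF _ refl])
    ultimately show ?case
      unfolding z_def
      by (intro conjI P.y_minus_z_tendsto_0[THEN LIMSEQ_imp_Suc]
          P.gradient_y_tendsto_0[THEN LIMSEQ_imp_Suc] P.gradient_z_tendsto_0[THEN LIMSEQ_imp_Suc]
          P.objective_y_minus_z_tendsto_0[THEN LIMSEQ_imp_Suc])
  qed
  define fstar where "fstar \<omega> = lim (\<lambda>k. f (z k \<omega>))" for \<omega>
  interpret f: smooth_objective f L by (rule f)
  have [measurable]: "x k \<in> borel_measurable M" for k
    using momentum by blast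
  have [measurable]: "z k \<in> borel_measurable M" for k
    unfolding z_def aux_seq_def[abs_def] by measurable
  have "fstar \<in> borel_measurable M"
    unfolding fstar_def[abs_def] by measurable
  moreover have "AE \<omega> in M. (\<lambda>k. f (x k \<omega>)) \<longlonglongrightarrow> fstar \<omega> \<and> (\<lambda>k. f (z k \<omega>)) \<longlonglongrightarrow> fstar \<omega>"
    using limits
  proof eventually_elim
    case (elim \<omega>)
    then have z: "(\<lambda>k. f (z k \<omega>)) \<longlonglongrightarrow> fstar \<omega>"
      by (simp add: fstar_def convergent_LIMSEQ_iff)
    moreover have "(\<lambda>k. (f (x k \<omega>) - f (z k \<omega>)) + f (z k \<omega>)) \<longlonglongrightarrow> 0 + fstar \<omega>"
      using elim z by (intro tendsto_add) auto
    ultimately show ?case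
      by simp
  qed
  ultimately show ?thesis
    using limits by (auto elim: eventually_mono)
qed

end
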